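(* Let $s\in[0,1]$ and $p\in[1,+\infty)$ be such that $sp<N$ and $s\neq p$. Let $\widetilde s\in[0,1]$ and $\widetilde p\in[1,+\infty]$. If $\widetilde s$ and $\widetilde p$ do not satisfy $$0\le\widetilde s\le s\qquad\text{and}\qquad p\le\widetilde p\le\frac{Np}{N-(s-\widetilde s)p},$$ then the space $W^{s,p}(\mathbb{R}^N)$ is not continuously embedded in $W^{\widetilde s,\widetilde p}(\mathbb{R}^N)$.
   Context: $N\ge1$ is an integer and functions are real-valued and measurable. Let $\Omega$ be either $\mathbb{R}^N$ or an open bounded subset of $\mathbb{R}^N$ with Lipschitz boundary. For $s\in[0,1]$ and $p\in[1,+\infty)$ define $[u]_{W^{0,p}(\Omega)}:=\|u\|_{L^p(\Omega)}$, $[u]_{W^{1,p}(\Omega)}:=\|\nabla u\|_{L^p(\Omega)}$ (weak gradient) and, for $s\in(0,1)$, $$[u]_{W^{s,p}(\Omega)}:=\left(c_{N,s,p}\iint_{\Omega\times\Omega}\frac{|u(x)-u(y)|^p}{|x-y|^{N+sp}}\,dx\,dy\right)^{1/p},\qquad c_{N,s,p}:=\frac{s\,2^{2s-1}\,\Gamma\left(\frac{ps+p+N-2}{2}\right)}{\pi^{N/2}\,\Gamma(1-s)}.$$ Set $W^{s,p}(\Omega):=\{u\in L^p(\Omega):[u]_{W^{s,p}(\Omega)}<+\infty\}$, with norm $\|u\|_{W^{0,p}(\Omega)}:=\|u\|_{L^p(\Omega)}$ if $s=0$ and $\|u\|_{W^{s,p}(\Omega)}:=\big([u]^p_{W^{s,p}(\Omega)}+\|u\|^p_{L^p(\Omega)}\big)^{1/p}$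 if $s\in(0,1]$. For $p=+\infty$: $W^{0,\infty}(\Omega):=L^\infty(\Omega)$ and, for $s\in(0,1]$, $W^{s,\infty}(\Omega):=C^{0,s}(\Omega)$ with norm $\|u\|_{L^\infty(\Omega)}+\sup_{x\neq y\in\Omega}\frac{|u(x)-u(y)|}{|x-y|^s}$ (functions being identified up to a.e. equality). *)

theory Defs
  imports "HOL-Probability.Essential_Supremum" "HOL-Analysis.Analysis"
begin

text \<open>
  Sobolev spaces \<open>W\<^sup>s\<^sup>,\<^sup>p(\<Omega>)\<close>, \<open>0 \<le> s \<le> 1\<close>, \<open>1 \<le> p \<le> \<infinity>\<close>, on an open set \<open>\<Omega>\<close>.
  Norms and seminorms are defined for all functions and take the value \<open>\<infinity>\<close> outside the
  corresponding space. Spaces are sets of functions rather than of a.e. equivalence classes;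
  they are closed under, and the norms are invariant under, a.e. equality on \<open>\<Omega>\<close>.
\<close>

text \<open>The power \<open>x\<^sup>a\<close> for \<open>x \<in> [0, \<infinity>]\<close>, only meant for exponents \<open>a > 0\<close>.\<close>

definition ennpowr :: "ennreal \<Rightarrow> real \<Rightarrow> ennreal" where
  "ennpowr x a = (if x = \<infinity> then \<infinity> else ennreal (enn2real x powr a))"

definition Lp_norm :: "'a::euclidean_space set \<Rightarrow> real \<Rightarrow> ('a \<Rightarrow> 'b::real_normed_vector) \<Rightarrow> ennreal" where
  "Lp_norm \<Omega> p f = ennpowr (\<integral>\<^sup>+x. ennreal (norm (f x) powr p) \<partial>lebesgue_on \<Omega>) (1 / p)"

definition Linf_norm :: "'a::euclidean_space set \<Rightarrow> ('a \<Rightarrow> real) \<Rightarrow> ennreal" where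
  "Linf_norm \<Omega> u = esssup (lebesgue_on \<Omega>) (\<lambda>x. ennreal \<bar>u x\<bar>)"

primrec Ck :: "nat \<Rightarrow> ('a::euclidean_space \<Rightarrow> real) \<Rightarrow> bool" where
  "Ck 0 f \<longleftrightarrow> continuous_on UNIV f"
| "Ck (Suc k) f \<longleftrightarrow> (\<forall>x. f differentiable (at x)) \<and>
     (\<forall>b\<in>Basis. Ck k (\<lambda>x. frechet_derivative f (at x) b))"

definition test_function :: "'a::euclidean_space set \<Rightarrow> ('a \<Rightarrow> real) \<Rightarrow> bool" where
  "test_function \<Omega> \<phi> \<longleftrightarrow>
     (\<forall>k. Ck k \<phi>) \<and> compact (closure {x. \<phi> x \<noteq> 0}) \<and> closure {x. \<phi> x \<noteq> 0} \<subseteq> \<Omega>"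

definition locally_integrable ::
    "'a::euclidean_space set \<Rightarrow> ('a \<Rightarrow> 'b::euclidean_space) \<Rightarrow> bool" where
  "locally_integrable \<Omega> f \<longleftrightarrow> (\<forall>K. compact K \<and> K \<subseteq> \<Omega> \<longrightarrow> integrable (lebesgue_on K) f)"

definition weak_gradient :: "'a::euclidean_space set \<Rightarrow> ('a \<Rightarrow> real) \<Rightarrow> ('a \<Rightarrow> 'a) \<Rightarrow> bool" where
  "weak_gradient \<Omega> u G \<longleftrightarrow> locally_integrable \<Omega> u \<and> locally_integrable \<Omega> G \<and>
     (\<forall>\<phi>. test_function \<Omega> \<phi> \<longrightarrow> (\<forall>b\<in>Basis.
        (\<integral>x. u x * frechet_derivative \<phi> (at x) b \<partial>lebesgue_on \<Omega>) =
        - (\<integral>x. (G x \<bullet> b) * \<phi> x \<partial>lebesgue_on \<Omega>)))"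

definition gagliardo_const :: "nat \<Rightarrow> real \<Rightarrow> real \<Rightarrow> real" where
  "gagliardo_const N s p =
     s * 2 powr (2 * s - 1) * Gamma ((p * s + p + real N - 2) / 2) /
     (pi powr (real N / 2) * Gamma (1 - s))"

text \<open>
  For \<open>s = 1\<close> the weak gradient is unique up to null sets, so that the infimum is the
  \<open>L\<^sup>p\<close> norm of the weak gradient if there is one, and \<open>\<infinity>\<close> otherwise.
  In the double integral, the integrand vanishes on the diagonal since \<open>0 / 0 = 0\<close>.
\<close>

definition sobolev_seminorm ::
    "'a::euclidean_space set \<Rightarrow> real \<Rightarrow> real \<Rightarrow> ('a \<Rightarrow> real) \<Rightarrow> ennreal" where
  "sobolev_seminorm \<Omega> s p u =
     (if s = 0 then Lp_norm \<Omega> p u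
      else if s = 1 then (INF G\<in>{G. weak_gradient \<Omega> u G}. Lp_norm \<Omega> p G)
      else ennpowr
        (ennreal (gagliardo_const DIM('a) s p) *
         (\<integral>\<^sup>+(x, y). ennreal (\<bar>u x - u y\<bar> powr p / norm (x - y) powr (real DIM('a) + s * p))
            \<partial>lebesgue_on (\<Omega> \<times> \<Omega>)))
        (1 / p))"

definition hoelder_seminorm ::
    "'a::euclidean_space set \<Rightarrow> real \<Rightarrow> ('a \<Rightarrow> real) \<Rightarrow> ennreal" where
  "hoelder_seminorm \<Omega> s v =
     (SUP (x, y)\<in>{(x, y). x \<in> \<Omega> \<and> y \<in> \<Omega> \<and> x \<noteq> y}. ennreal (\<bar>v x - v y\<bar> / norm (x - y) powr s))"

text \<open>
  For \<open>p = \<infinity>\<close> and \<open>s > 0\<close> the infimum runs over all representatives of \<open>u\<close>. At most one of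
  them is continuous on \<open>\<Omega>\<close>, and all others have infinite Hoelder seminorm, so that
  the infimum is the \<open>C\<^sup>0\<^sup>,\<^sup>s\<close> norm of the continuous representative.
\<close>

definition sobolev_norm ::
    "'a::euclidean_space set \<Rightarrow> real \<Rightarrow> ereal \<Rightarrow> ('a \<Rightarrow> real) \<Rightarrow> ennreal" where
  "sobolev_norm \<Omega> s p u =
     (if p = \<infinity> then
        (if s = 0 then Linf_norm \<Omega> u
         else (INF v\<in>{v. AE x in lebesgue_on \<Omega>. v x = u x}. Linf_norm \<Omega> v + hoelder_seminorm \<Omega> s v))
      else
        (let q = real_of_ereal p in
         if s = 0 then Lp_norm \<Omega> q u
         else ennpowr (ennpowr (sobolev_seminorm \<Omega> s q u) q + ennpowr (Lp_norm \<Omega> q u) q) (1 / q)))"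

definition sobolev_space ::
    "'a::euclidean_space set \<Rightarrow> real \<Rightarrow> ereal \<Rightarrow> ('a \<Rightarrow> real) set" where
  "sobolev_space \<Omega> s p =
     (if p = \<infinity> then {u \<in> borel_measurable (lebesgue_on \<Omega>). sobolev_norm \<Omega> s p u < \<infinity>}
      else {u \<in> borel_measurable (lebesgue_on \<Omega>).
              Lp_norm \<Omega> (real_of_ereal p) u < \<infinity> \<and> sobolev_seminorm \<Omega> s (real_of_ereal p) u < \<infinity>})"

definition sobolev_embedded ::
    "'a::euclidean_space set \<Rightarrow> real \<Rightarrow> ereal \<Rightarrow> real \<Rightarrow> ereal \<Rightarrow> bool" where
  "sobolev_embedded \<Omega> s p s' p' \<longleftrightarrow>
     sobolev_space \<Omega> s p \<subseteq> sobolev_space \<Omega> s' p' \<and>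
     (\<exists>C::real. \<forall>u\<in>sobolev_space \<Omega> s p. sobolev_norm \<Omega> s' p' u \<le> ennreal C * sobolev_norm \<Omega> s p u)"

end

theory Submission
  imports Defs
begin

text \<open>
  Scaling argument: for a fixed nonzero test function \<open>u\<close> and \<open>u\<^sub>c x = u (c x)\<close>, every seminorm
  \<open>[u\<^sub>c]\<close> of \<open>W\<^sup>s\<^sup>,\<^sup>p\<close> is of the exact order \<open>c\<close> to the power \<open>s - N / p\<close> (with \<open>N / \<infinity> = 0\<close>).
  If \<open>p' < p\<close>, the \<open>L\<^sup>p\<close> parts of the norms contradict a continuous embedding as \<open>c \<rightarrow> 0\<close>;
  in all other excluded cases \<open>s' - N / p' > s - N / p\<close>, and letting \<open>c \<rightarrow> \<infinity>\<close> gives the contradiction.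
\<close>

subsection \<open>Powers and test functions\<close>

text \<open>The norm of the source space combines two parts of orders
  \<open>c powr (s - N / p)\<close> and \<open>c powr (- (N / p))\<close>. The first dominates for
  \<open>c \<ge> 1\<close>, the second for \<open>c \<le> 1\<close>; hence small \<open>c\<close>
  compares Lebesgue exponents only, while large \<open>c\<close> compares the numbers
  \<open>s - N / p\<close>. The upper limit \<open>N p / (N - (s - s') p)\<close> for
  \<open>p'\<close> is the solution of \<open>s' - N / p' = s - N / p\<close>; the condition
  \<open>s p < N\<close> makes its denominator positive when \<open>s' \<le> s\<close> and gives
  \<open>s - N / p < 0\<close> for the case \<open>p' = \<infinity>\<close>. The obstacle lies in
  the lower bounds. Two of the target norms are infima, over weak gradients for
  \<open>s' = 1\<close> and over a.e. representatives for \<open>p' = \<infinity>\<close>,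
  \<open>s' > 0\<close>, so the estimate has to be uniform over all competitors. Weak gradients are
  controlled by testing the defining identity, representatives by picking points of open sets
  outside a null set. The upper bounds rest on the finiteness of fractional seminorms of test
  functions, hence on the integrability of powers of the norm near the origin and at
  infinity.\<close>

lemma ennpowr_ennreal: "0 \<le> x \<Longrightarrow> ennpowr (ennreal x) a = ennreal (x powr a)"
  by (simp add: ennpowr_def)

lemma ennpowr_mono:
  assumes "x \<le> y" "0 < a"
  shows "ennpowr x a \<le> ennpowr y a"
proof (cases "y = \<infinity>")
  case False
  then have "enn2real x \<le> enn2real y" "x \<noteq> \<infinity>"
    using assms by (auto simp: enn2real_mono less_top top_unique)
  then show ?thesis
    using False assms by (simp add: ennpowr_def powr_mono2)
qed (simp add: ennpowr_def)

lemma ennpowr_less_top: "x < \<infinity> \<Longrightarrow> ennpowr x a < \<infinity>"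
  by (simp add: ennpowr_def)

lemma ennpowr_pos: "0 < x \<Longrightarrow> 0 < ennpowr x a"
  by (cases x) (auto simp: ennpowr_def ennreal_zero_less_top)

lemma ennpowr_cmult:
  assumes "0 < c"
  shows "ennpowr (ennreal c * x) a = ennreal (c powr a) * ennpowr x a"
proof (cases x)
  case (real r)
  then show ?thesis
    using assms by (simp add: ennpowr_ennreal powr_mult flip: ennreal_mult)
qed (use assms in \<open>simp add: ennpowr_def ennreal_mult_top\<close>)

lemma ennpowr_ennpowr_inverse: "0 < a \<Longrightarrow> ennpowr (ennpowr x a) (1 / a) = x"
  by (cases x) (auto simp: ennpowr_ennreal powr_powr, simp add: ennpowr_def)

lemma ennpowr_exhaust:
  assumes "0 < x" "x < \<infinity>"
  obtains r where "0 < r" "x = ennreal r"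
  using assms by (cases x) auto

text \<open>The functions \<open>P(1/t) exp(-1/t)\<close>, extended by \<open>0\<close> to \<open>t \<le> 0\<close>, are closed under derivatives; hence all are smooth.\<close>

lemma has_real_derivative_flat:
  fixes P :: "real poly"
  defines "flat \<equiv> \<lambda>P t. if t \<le> 0 then 0 else poly P (1 / t) * exp (- 1 / t)"
  shows "(flat P has_real_derivative flat ([:0, 0, 1:] * (P - pderiv P)) t) (at t)"
proof -
  consider "t < 0" | "t > 0" | "t = 0" by linarith
  then show ?thesis
  proof cases
    case 1
    have "((\<lambda>_. 0) has_real_derivative flat ([:0, 0, 1:] * (P - pderiv P)) t) (at t)"
      using 1 by (simp add: flat_def)
    then show ?thesis
      by (rule has_field_derivative_transform_within[where d = "-t"]) (use 1 in \<open>auto simp: flat_def dist_real_def\<close>)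
  next
    case 2
    \<comment> \<open>With \<open>y = 1 / t\<close> one has \<open>dy / dt = - y^2\<close>, and
      \<open>P(y) exp(-y)\<close> has derivative \<open>(P'(y) - P(y)) exp(-y)\<close> in
      \<open>y\<close>. The product of the two is the origin of
      \<open>[:0, 0, 1:] * (P - pderiv P)\<close>.\<close>
    have "((\<lambda>t. poly P (1 / t) * exp (- 1 / t)) has_real_derivative
        flat ([:0, 0, 1:] * (P - pderiv P)) t) (at t)"
      using 2 by (auto intro!: derivative_eq_intros DERIV_chain2[where f = "poly P"]
        simp: flat_def algebra_simps power2_eq_square)
    then show ?thesis
      by (rule has_field_derivative_transform_within[where d = t]) (use 2 in \<open>auto simp: flat_def dist_real_def\<close>)
  next
    case 3
    have mon: "((\<lambda>y. poly Q y * exp (- y)) \<longlongrightarrow> 0) at_top" for Q :: "real poly"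
    proof -
      have "((\<lambda>y. \<Sum>i\<le>degree Q. coeff Q i * (y ^ i / exp y)) \<longlongrightarrow> (\<Sum>i\<le>degree Q. coeff Q i * 0)) at_top"
        by (intro tendsto_intros tendsto_power_div_exp_0)
      then show ?thesis
        by (simp add: poly_altdef sum_distrib_right exp_minus divide_inverse mult.assoc)
    qed
    have "((\<lambda>t. flat P t / t) \<longlongrightarrow> 0) (at_right 0)"
    proof -
      \<comment> \<open>The shift \<open>pCons 0 P\<close> multiplies \<open>P\<close> by its
        argument \<open>1 / t\<close>, which is the denominator of the difference quotient at
        \<open>0\<close>.\<close>
      have "((\<lambda>t. poly (pCons 0 P) (inverse t) * exp (- inverse t)) \<longlongrightarrow> 0) (at_right 0)"
        by (rule filterlim_compose[OF mon filterlim_inverse_at_top_right])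
      moreover have "\<forall>\<^sub>F t in at_right 0. poly (pCons 0 P) (inverse t) * exp (- inverse t) = flat P t / t"
        by (auto simp: eventually_at flat_def field_simps intro!: exI[of _ 1])
      ultimately show ?thesis
        by (rule Lim_transform_eventually)
    qed
    moreover have "((\<lambda>t. flat P t / t) \<longlongrightarrow> 0) (at_left 0)"
      by (rule Lim_transform_eventually[where f = "\<lambda>_. 0"])
        (auto simp: eventually_at flat_def intro!: exI[of _ 1])
    ultimately have "((\<lambda>t. flat P t / t) \<longlongrightarrow> 0) (at 0)"
      by (simp add: filterlim_at_split)
    \<comment> \<open>For \<open>Q = P\<close> this gives the base value in the difference quotient,
      and for the transformed polynomial it says that the claimed derivative at \<open>0\<close> is
      \<open>0\<close>.\<close>
    moreover have "flat Q 0 = 0" for Q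
      by (simp add: flat_def)
    ultimately show ?thesis
      using 3 by (simp add: DERIV_def)
  qed
qed

section \<open>Closure properties of the classes \<open>Ck k\<close>\<close>

lemma Ck_Suc_imp_Ck: "Ck (Suc k) f \<Longrightarrow> Ck k f"
proof (induction k arbitrary: f)
  case 0
  then show ?case
    by (simp add: continuous_on_eq_continuous_at differentiable_imp_continuous_within)
qed simp

text \<open>Derivatives are unique, so the value chosen by \<open>frechet_derivative\<close> agrees
  with any exhibited \<open>f'\<close>; the inductions below can therefore work with explicit
  derivatives.\<close>

lemma Ck_SucI:
  assumes "\<And>x. (f has_derivative f' x) (at x)" "\<And>b. b \<in> Basis \<Longrightarrow> Ck k (\<lambda>x. f' x b)"
  shows "Ck (Suc k) f"
proof -
  have "frechet_derivative f (at x) = f' x" for x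
    using frechet_derivative_at[OF assms(1)] by simp
  then show ?thesis
    using assms by (auto simp: differentiable_def)
qed

lemma Ck_SucD:
  assumes "Ck (Suc k) f"
  shows "(f has_derivative frechet_derivative f (at x)) (at x)"
    and "b \<in> Basis \<Longrightarrow> Ck k (\<lambda>x. frechet_derivative f (at x) b)"
  using assms by (auto simp: frechet_derivative_works[symmetric])

lemma Ck_const: "Ck k (\<lambda>_. c)"
proof (induction k arbitrary: c)
  case (Suc k)
  then show ?case
    by (intro Ck_SucI[where f' = "\<lambda>_ _. 0"]) auto
qed simp

lemma Ck_add: "Ck k f \<Longrightarrow> Ck k g \<Longrightarrow> Ck k (\<lambda>x. f x + g x)"
proof (induction k arbitrary: f g)
  case 0
  then show ?case by (auto intro: continuous_intros)
next
  case (Suc k)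
  show ?case
    by (rule Ck_SucI[OF has_derivative_add[OF Suc.prems[THEN Ck_SucD(1)]]])
      (intro Suc.IH Suc.prems[THEN Ck_SucD(2)])
qed

lemma Ck_mult: "Ck k f \<Longrightarrow> Ck k g \<Longrightarrow> Ck k (\<lambda>x. f x * g x)"
proof (induction k arbitrary: f g)
  case 0
  then show ?case by (auto intro: continuous_intros)
next
  case (Suc k)
  show ?case
    by (rule Ck_SucI[OF has_derivative_mult[OF Suc.prems[THEN Ck_SucD(1)]]])
      (intro Ck_add Suc.IH Suc.prems[THEN Ck_SucD(2)] Suc.prems[THEN Ck_Suc_imp_Ck])
qed

lemma Ck_inner: "Ck k (\<lambda>x. a \<bullet> x)"
proof (cases k)
  case (Suc k)
  show ?thesis
    unfolding Suc by (rule Ck_SucI[where f' = "\<lambda>_ h. a \<bullet> h"]) (auto intro!: derivative_eq_intros Ck_const)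
qed (auto intro: continuous_intros)

lemma Ck_inner_self: "Ck k (\<lambda>x. x \<bullet> x)"
proof (cases k)
  case (Suc k)
  show ?thesis
    unfolding Suc
    by (rule Ck_SucI[where f' = "\<lambda>x h. 2 * (x \<bullet> h)"])
      (auto intro!: derivative_eq_intros Ck_mult Ck_const Ck_inner simp: inner_commute)
qed (auto intro: continuous_intros)

lemma Ck_scale: "Ck k f \<Longrightarrow> Ck k (\<lambda>x. f (c *\<^sub>R x))"
proof (induction k arbitrary: f)
  case 0
  then show ?case
    by (auto intro!: continuous_on_compose2[where f = "\<lambda>x. c *\<^sub>R x"] continuous_intros)
next
  case (Suc k)
  have "((\<lambda>x. f (c *\<^sub>R x)) has_derivative (\<lambda>h. frechet_derivative f (at (c *\<^sub>R x)) (c *\<^sub>R h))) (at x)" for x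
    by (rule has_derivative_compose[where f = "\<lambda>x. c *\<^sub>R x", OF _ Ck_SucD(1)[OF Suc.prems]])
      (auto intro!: derivative_eq_intros)
  moreover have "frechet_derivative f (at (c *\<^sub>R x)) (c *\<^sub>R b) = c * frechet_derivative f (at (c *\<^sub>R x)) b" for x b
    using linear_scale[OF has_derivative_linear[OF Ck_SucD(1)[OF Suc.prems]]] by simp
  ultimately show ?case
    by (intro Ck_SucI[where f' = "\<lambda>x h. c * frechet_derivative f (at (c *\<^sub>R x)) h"])
      (auto intro!: Ck_mult Ck_const Suc.IH Ck_SucD(2)[OF Suc.prems])
qed

text \<open>The chain rule replaces \<open>h P\<close> by another member \<open>h (D P)\<close> of
  the same family, so the induction on \<open>k\<close> closes once it is run for all
  \<open>P\<close> simultaneously. It serves to compose the flat functions with a polynomial in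
  \<open>x\<close>.\<close>

lemma Ck_compose_chain:
  assumes h: "\<And>P t. (h P has_real_derivative h (D P) t) (at t)"
  shows "Ck k q \<Longrightarrow> Ck k (\<lambda>x. h P (q x))"
proof (induction k arbitrary: P)
  case 0
  have "continuous_on UNIV (h P)"
    using h by (intro continuous_at_imp_continuous_on ballI DERIV_isCont)
  then show ?case
    using 0 by (auto intro: continuous_on_compose2)
next
  case (Suc k)
  have "((\<lambda>x. h P (q x)) has_derivative (\<lambda>a. h (D P) (q x) * frechet_derivative q (at x) a)) (at x)" for x
    using has_derivative_compose[OF Ck_SucD(1)[OF Suc.prems] h[THEN has_field_derivative_imp_has_derivative]] .
  then show ?case
    by (rule Ck_SucI) (intro Ck_mult Suc.IH Ck_SucD(2)[OF Suc.prems] Ck_Suc_imp_Ck[OF Suc.prems])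
qed

section \<open>Test functions on the whole space, with compact support read as vanishing outside a
  ball\<close>

lemma test_function_UNIV_iff:
  "test_function UNIV \<phi> \<longleftrightarrow> (\<forall>k. Ck k \<phi>) \<and> (\<exists>R. \<forall>x. R < norm x \<longrightarrow> \<phi> x = 0)" (is "?L \<longleftrightarrow> ?R")
proof
  assume L: ?L
  then obtain R where "\<And>x. x \<in> closure {x. \<phi> x \<noteq> 0} \<Longrightarrow> norm x \<le> R"
    using compact_imp_bounded bounded_iff unfolding test_function_def by metis
  then have "\<forall>x. R < norm x \<longrightarrow> \<phi> x = 0"
    using closure_subset[of "{x. \<phi> x \<noteq> 0}"] by fastforce
  with L show ?R
    unfolding test_function_def by blast
next
  assume R: ?R
  then obtain R where "\<And>x. R < norm x \<Longrightarrow> \<phi> x = 0" by blast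
  then have "closure {x. \<phi> x \<noteq> 0} \<subseteq> cball 0 R"
    by (intro closure_minimal) (auto simp: not_less[symmetric])
  then have "compact (closure {x. \<phi> x \<noteq> 0})"
    by (metis bounded_cball bounded_subset closed_closure compact_eq_bounded_closed)
  with R show ?L
    by (auto simp: test_function_def)
qed

lemma ex_test_function:
  obtains \<phi> :: "'a::euclidean_space \<Rightarrow> real" where "test_function UNIV \<phi>" "\<phi> 0 \<noteq> 0"
proof -
  define flat where "flat \<equiv> \<lambda>(P::real poly) (t::real). if t \<le> 0 then 0 else poly P (1 / t) * exp (- 1 / t)"
  \<comment> \<open>The standard bump \<open>exp (-1 / (1 - |x|^2))\<close> on the unit ball; the
    difference is spelled as a sum and a product to fit \<open>Ck_add\<close> and
    \<open>Ck_mult\<close>.\<close>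
  define \<phi> where "\<phi> = (\<lambda>x::'a. flat 1 (1 + (-1) * (x \<bullet> x)))"
  have "Ck k \<phi>" for k
    unfolding \<phi>_def
    by (rule Ck_compose_chain[where D = "\<lambda>P. [:0, 0, 1:] * (P - pderiv P)"])
      (auto simp only: flat_def intro!: has_real_derivative_flat Ck_add Ck_mult Ck_const Ck_inner_self)
  moreover have "\<forall>x. 1 < norm x \<longrightarrow> \<phi> x = 0"
    by (auto simp: \<phi>_def flat_def norm_eq_sqrt_inner)
  moreover have "\<phi> 0 \<noteq> 0"
    by (simp add: \<phi>_def flat_def)
  ultimately show ?thesis
    by (intro that[of \<phi>]) (auto simp: test_function_UNIV_iff)
qed

lemma test_functionD:
  assumes "test_function UNIV \<phi>"
  shows "Ck k \<phi>" and "\<phi> differentiable (at x)"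
    and "(\<phi> has_derivative frechet_derivative \<phi> (at x)) (at x)"
    and "continuous_on UNIV \<phi>"
proof -
  show "Ck k \<phi>" for k
    using assms by (simp add: test_function_def)
  from this[of 1] this[of 0] show "\<phi> differentiable (at x)"
    "(\<phi> has_derivative frechet_derivative \<phi> (at x)) (at x)" "continuous_on UNIV \<phi>"
    by (auto simp: frechet_derivative_works[symmetric])
qed

lemma test_function_support:
  assumes "test_function UNIV \<phi>"
  obtains R where "0 < R" "\<And>x. R < norm x \<Longrightarrow> \<phi> x = 0"
proof -
  obtain R where "\<And>x. R < norm x \<Longrightarrow> \<phi> x = 0"
    using assms unfolding test_function_UNIV_iff by blast
  then show ?thesis
    by (intro that[of "max R 1"]) auto
qed

lemma test_function_bounded:
  assumes "test_function UNIV \<phi>"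
  obtains M where "0 < M" "\<And>x. \<bar>\<phi> x\<bar> \<le> M"
proof -
  obtain R where R: "0 < R" "\<And>x. R < norm x \<Longrightarrow> \<phi> x = 0"
    using test_function_support[OF assms] by blast
  have "compact (\<phi> ` cball 0 R)"
    by (intro compact_continuous_image compact_cball continuous_on_subset[OF test_functionD(4)[OF assms]]) auto
  then obtain M where M: "\<And>x. norm x \<le> R \<Longrightarrow> \<bar>\<phi> x\<bar> \<le> M"
    by (force simp: bounded_iff dest: compact_imp_bounded)
  have "\<bar>\<phi> x\<bar> \<le> max M 1" for x
    using M[of x] R(2)[of x] by (cases "norm x \<le> R") auto
  then show ?thesis
    by (intro that[of "max M 1"]) auto
qed

lemma frechet_derivative_eq_0_outside:
  fixes \<phi> :: "'a::euclidean_space \<Rightarrow> real"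
  assumes "\<And>x. R < norm x \<Longrightarrow> \<phi> x = 0" "R < norm x"
  shows "frechet_derivative \<phi> (at x) = (\<lambda>_. 0)"
proof -
  have "((\<lambda>_. 0) has_derivative (\<lambda>_. 0)) (at x)" by simp
  moreover have "open {x::'a. R < norm x}"
    by (intro open_Collect_less continuous_intros)
  ultimately have "(\<phi> has_derivative (\<lambda>_. 0)) (at x)"
    by (rule has_derivative_transform_within_open) (use assms in auto)
  then show ?thesis
    by (rule frechet_derivative_at[symmetric])
qed

lemma test_function_frechet_derivative:
  assumes "test_function UNIV \<phi>" "b \<in> Basis"
  shows "test_function UNIV (\<lambda>x. frechet_derivative \<phi> (at x) b)"
proof -
  obtain R where R: "0 < R" "\<And>x. R < norm x \<Longrightarrow> \<phi> x = 0"
    using test_function_support[OF assms(1)] by blast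
  have "Ck k (\<lambda>x. frechet_derivative \<phi> (at x) b)" for k
    using test_functionD(1)[OF assms(1), of "Suc k"] assms(2) by simp
  with frechet_derivative_eq_0_outside[of R \<phi>, OF R(2)] show ?thesis
    by (auto simp: test_function_UNIV_iff intro!: exI[of _ R])
qed

lemma test_function_mult:
  assumes "test_function UNIV \<phi>" "test_function UNIV \<psi>"
  shows "test_function UNIV (\<lambda>x. \<phi> x * \<psi> x)"
  using assms unfolding test_function_UNIV_iff by (force intro: Ck_mult)

lemma test_function_scale:
  assumes "test_function UNIV \<phi>" "0 < c"
  shows "test_function UNIV (\<lambda>x. \<phi> (c *\<^sub>R x))"
proof -
  obtain R where R: "0 < R" "\<And>x. R < norm x \<Longrightarrow> \<phi> x = 0"
    using test_function_support[OF assms(1)] by blast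
  have "\<phi> (c *\<^sub>R x) = 0" if "R / c < norm x" for x
    using that assms(2) by (intro R(2)) (simp add: field_simps)
  then show ?thesis
    using assms unfolding test_function_UNIV_iff by (auto intro: Ck_scale)
qed

lemma frechet_derivative_scale:
  assumes "test_function UNIV \<phi>"
  shows "frechet_derivative (\<lambda>x. \<phi> (c *\<^sub>R x)) (at x) b = c * frechet_derivative \<phi> (at (c *\<^sub>R x)) b"
proof -
  have "((\<lambda>x. \<phi> (c *\<^sub>R x)) has_derivative (\<lambda>h. frechet_derivative \<phi> (at (c *\<^sub>R x)) (c *\<^sub>R h))) (at x)"
    by (rule has_derivative_compose[where f = "\<lambda>x. c *\<^sub>R x", OF _ test_functionD(3)[OF assms]])
      (auto intro!: derivative_eq_intros)
  then have "frechet_derivative (\<lambda>x. \<phi> (c *\<^sub>R x)) (at x) b = frechet_derivative \<phi> (at (c *\<^sub>R x)) (c *\<^sub>R b)"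
    by (simp flip: frechet_derivative_at)
  then show ?thesis
    using linear_scale[OF has_derivative_linear[OF test_functionD(3)[OF assms]]] by simp
qed

text \<open>The partial derivatives are again test functions, hence bounded. The sum of their bounds
  controls the operator norm of the derivative, and the mean value inequality concludes.\<close>

lemma test_function_lipschitz:
  fixes \<phi> :: "'a::euclidean_space \<Rightarrow> real"
  assumes "test_function UNIV \<phi>"
  obtains L where "0 < L" "\<And>x y. \<bar>\<phi> x - \<phi> y\<bar> \<le> L * norm (x - y)"
proof -
  have "\<exists>M. \<forall>x. \<bar>frechet_derivative \<phi> (at x) b\<bar> \<le> M" if "b \<in> Basis" for b
    using test_function_bounded[OF test_function_frechet_derivative[OF assms that]] by metis
  then obtain M where M: "\<And>b x. b \<in> Basis \<Longrightarrow> \<bar>frechet_derivative \<phi> (at x) b\<bar> \<le> M b"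
    by metis
  define L where "L = (\<Sum>b\<in>Basis. M b)"
  have "onorm (frechet_derivative \<phi> (at x)) \<le> L" for x
  proof (rule onorm_le)
    fix h
    note lin = has_derivative_linear[OF test_functionD(3)[OF assms, of x]]
    have "frechet_derivative \<phi> (at x) h = frechet_derivative \<phi> (at x) (\<Sum>b\<in>Basis. (h \<bullet> b) *\<^sub>R b)"
      by (simp add: euclidean_representation)
    also have "\<dots> = (\<Sum>b\<in>Basis. (h \<bullet> b) * frechet_derivative \<phi> (at x) b)"
      using lin by (simp add: linear_sum linear_scale)
    also have "\<bar>\<dots>\<bar> \<le> (\<Sum>b\<in>Basis. norm h * M b)"
      by (intro sum_abs[THEN order_trans] sum_mono)
        (auto simp: abs_mult Basis_le_norm intro!: mult_mono M)
    finally show "norm (frechet_derivative \<phi> (at x) h) \<le> L * norm h"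
      by (simp add: L_def sum_distrib_right mult.commute[of "norm h"])
  qed
  then have "norm (\<phi> x - \<phi> y) \<le> L * norm (x - y)" for x y
    using test_functionD(3)[OF assms] by (intro differentiable_bound[of UNIV]) auto
  then have "\<bar>\<phi> x - \<phi> y\<bar> \<le> max L 1 * norm (x - y)" for x y
    by (smt (verit) real_norm_def mult_right_mono norm_ge_zero)
  then show ?thesis
    by (intro that[of "max L 1"]) auto
qed

subsection \<open>Integration by parts and integrals of powers of the norm\<close>

text \<open>The substitution takes place in \<open>lborel\<close> and passes to its completion
  because \<open>f\<close> is Borel. Besides dilations, the reflection \<open>c = -1\<close> with a
  translation is used later, for integrating \<open>w (x - y)\<close> over \<open>y\<close>.\<close>

lemma nn_integral_lebesgue_affine:
  fixes f :: "'a::euclidean_space \<Rightarrow> ennreal"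
  assumes [measurable]: "f \<in> borel_measurable borel" and c: "c \<noteq> 0"
  shows "(\<integral>\<^sup>+x. f (t + c *\<^sub>R x) \<partial>lebesgue) =
    ennreal (\<bar>c\<bar> powr (- real DIM('a))) * (\<integral>\<^sup>+x. f x \<partial>lebesgue)"
proof -
  have "(\<integral>\<^sup>+x. f x \<partial>lborel) = ennreal (\<bar>c\<bar> ^ DIM('a)) * (\<integral>\<^sup>+x. f (t + c *\<^sub>R x) \<partial>lborel)"
    by (subst lborel_affine[OF c, of t])
      (simp add: nn_integral_density nn_integral_distr nn_integral_cmult)
  moreover have "ennreal (\<bar>c\<bar> powr (- real DIM('a))) * ennreal (\<bar>c\<bar> ^ DIM('a)) = 1"
    using c by (simp add: powr_minus powr_realpow flip: ennreal_mult)
  ultimately show ?thesis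
    by (simp add: nn_integral_completion flip: mult.assoc)
qed

lemma integral_lebesgue_translate:
  fixes f :: "'a::euclidean_space \<Rightarrow> real"
  assumes [measurable]: "f \<in> borel_measurable borel"
  shows "(\<integral>x. f (t + x) \<partial>lebesgue) = (\<integral>x. f x \<partial>lebesgue)"
proof -
  have "(\<integral>x. f x \<partial>lborel) = (\<integral>x. f (t + x) \<partial>lborel)"
    by (subst lborel_distr_plus[of t, symmetric]) (simp add: integral_distr)
  then show ?thesis
    by (simp add: integral_completion)
qed

lemma integral_lebesgue_scale:
  fixes f :: "'a::euclidean_space \<Rightarrow> real"
  assumes [measurable]: "f \<in> borel_measurable borel" and c: "0 < c"
  shows "(\<integral>x. f (c *\<^sub>R x) \<partial>lebesgue) = c powr (- real DIM('a)) * (\<integral>x. f x \<partial>lebesgue)"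
proof -
  have "(\<integral>x. f x \<partial>lborel) = c ^ DIM('a) * (\<integral>x. f (c *\<^sub>R x) \<partial>lborel)"
    using c by (subst lborel_affine[of c 0])
      (simp_all add: integral_density integral_distr integral_real_density)
  then show ?thesis
    using c by (simp add: integral_completion powr_minus powr_realpow field_simps)
qed

text \<open>A nonempty open set is not negligible. This turns a.e. information into information at
  actual points and underlies all positivity statements and the bounds for
  \<open>p' = \<infinity>\<close>.\<close>

lemma AE_lebesgue_open_obtains:
  fixes S :: "'a::euclidean_space set"
  assumes "AE x in lebesgue. P x" "open S" "S \<noteq> {}"
  obtains x where "x \<in> S" "P x"
proof -
  obtain Z where Z: "Z \<in> null_sets lebesgue" "{x. \<not> P x} \<subseteq> Z"
    using assms(1) by (auto simp: eventually_ae_filter)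
  then have "\<not> S \<subseteq> Z"
    using open_not_negligible[OF assms(2,3)] negligible_iff_null_sets negligible_subset by blast
  then show ?thesis
    using that Z(2) by blast
qed

lemma nn_integral_lebesgue_pos:
  fixes f :: "'a::euclidean_space \<Rightarrow> ennreal"
  assumes "f \<in> borel_measurable borel" "open S" "S \<noteq> {}" "\<And>x. x \<in> S \<Longrightarrow> f x \<noteq> 0"
  shows "0 < (\<integral>\<^sup>+x. f x \<partial>lebesgue)"
proof (rule ccontr)
  assume "\<not> ?thesis"
  then have "AE x in lebesgue. f x = 0"
    using assms(1) by (subst (asm) nn_integral_completion)
      (simp add: nn_integral_0_iff_AE AE_completion)
  then show False
    using assms(2-4) AE_lebesgue_open_obtains by blast
qed

lemma integrable_lebesgue_on_continuous:
  fixes f :: "'a::euclidean_space \<Rightarrow> 'b::euclidean_space"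
  assumes "continuous_on UNIV f" "compact K"
  shows "integrable (lebesgue_on K) f"
proof -
  have K: "K \<in> sets borel"
    using assms(2) by (intro borel_compact)
  have [measurable]: "f \<in> borel_measurable borel"
    using assms(1) by (rule borel_measurable_continuous_onI)
  have "integrable lborel (\<lambda>x. indicator K x *\<^sub>R f x)"
    using assms by (intro borel_integrable_compact continuous_on_subset[OF assms(1)]) auto
  then have "integrable lebesgue (\<lambda>x. indicator K x *\<^sub>R f x)"
    using K by (subst integrable_completion) auto
  then show ?thesis
    using K by (subst integrable_restrict_space) auto
qed

lemma integrable_lebesgue_test_function:
  fixes \<phi> :: "'a::euclidean_space \<Rightarrow> real"
  assumes "test_function UNIV \<phi>"
  shows "integrable lebesgue \<phi>"
proof -
  obtain R where R: "0 < R" "\<And>x. R < norm x \<Longrightarrow> \<phi> x = 0"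
    using test_function_support[OF assms] by blast
  have "integrable (lebesgue_on (cball 0 R)) \<phi>"
    by (intro integrable_lebesgue_on_continuous test_functionD(4)[OF assms] compact_cball)
  then have "integrable lebesgue (\<lambda>x. indicator (cball 0 R) x *\<^sub>R \<phi> x)"
    by (subst (asm) integrable_restrict_space) auto
  also have "(\<lambda>x. indicator (cball 0 R) x *\<^sub>R \<phi> x) = \<phi>"
    using R(2) by (force simp: indicator_def)
  finally show ?thesis .
qed

lemma borel_measurable_test_function:
  fixes \<phi> :: "'a::euclidean_space \<Rightarrow> real"
  assumes "test_function UNIV \<phi>"
  shows "\<phi> \<in> borel_measurable borel"
  using test_functionD(4)[OF assms] by (rule borel_measurable_continuous_onI)

text \<open>By translation invariance all difference quotients have integral \<open>0\<close>; then dominated convergence.\<close>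

lemma integral_frechet_derivative_eq_0:
  fixes \<phi> :: "'a::euclidean_space \<Rightarrow> real"
  assumes test: "test_function UNIV \<phi>" and b: "b \<in> Basis"
  shows "(\<integral>x. frechet_derivative \<phi> (at x) b \<partial>lebesgue) = 0"
proof -
  obtain L where L: "0 < L" "\<And>x y. \<bar>\<phi> x - \<phi> y\<bar> \<le> L * norm (x - y)"
    using test_function_lipschitz[OF test] by blast
  obtain R where R: "0 < R" "\<And>x. R < norm x \<Longrightarrow> \<phi> x = 0"
    using test_function_support[OF test] by blast
  have [measurable]: "\<phi> \<in> borel_measurable borel"
    "(\<lambda>x. frechet_derivative \<phi> (at x) b) \<in> borel_measurable borel"
    using test test_function_frechet_derivative[OF test b] by (auto intro: borel_measurable_test_function)
  have int: "integrable lborel \<phi>"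
    using integrable_lebesgue_test_function[OF test] by (subst (asm) integrable_completion) auto
  define h :: "nat \<Rightarrow> real" where "h n = 1 / Suc n" for n
  have h: "0 < h n" "h n \<le> 1" for n
    by (auto simp: h_def field_simps)
  define f where "f n x = (\<phi> (h n *\<^sub>R b + x) - \<phi> x) / h n" for n x
  have [measurable]: "f n \<in> borel_measurable borel" for n
    unfolding f_def by measurable
  have "integrable lborel (\<lambda>x. \<phi> (t + x))" for t
    using int by (subst (asm) lborel_distr_plus[of t, symmetric]) (simp add: integrable_distr_eq)
  moreover have "(\<integral>x. \<phi> (t + x) \<partial>lborel) = (\<integral>x. \<phi> x \<partial>lborel)" for t
    using integral_lebesgue_translate[of \<phi> t] by (simp add: integral_completion)
  ultimately have zero: "(\<integral>x. f n x \<partial>lborel) = 0" for n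
    using int by (simp add: f_def)
  have "(\<lambda>n. f n x) \<longlonglongrightarrow> frechet_derivative \<phi> (at x) b" for x
  proof -
    have "((\<lambda>t. \<phi> (x + t *\<^sub>R b)) has_derivative (\<lambda>t. frechet_derivative \<phi> (at x) (t *\<^sub>R b))) (at 0)"
      by (rule has_derivative_compose[where f = "\<lambda>t. x + t *\<^sub>R b"])
        (auto intro!: derivative_eq_intros test_functionD(3)[OF test])
    then have "((\<lambda>t. \<phi> (x + t *\<^sub>R b)) has_real_derivative frechet_derivative \<phi> (at x) b) (at 0)"
      using linear_scale[OF has_derivative_linear[OF test_functionD(3)[OF test, of x]]]
      by (simp add: has_field_derivative_def mult.commute[of _ "frechet_derivative \<phi> (at x) b"])
    then have "((\<lambda>t. (\<phi> (x + t *\<^sub>R b) - \<phi> x) / t) \<longlongrightarrow> frechet_derivative \<phi> (at x) b) (at 0)"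
      by (simp add: DERIV_def)
    moreover have "filterlim h (at 0) sequentially"
      using h unfolding h_def filterlim_at
      by (auto intro!: lim_1_over_n[THEN LIMSEQ_Suc] simp del: of_nat_Suc)
    ultimately show ?thesis
      unfolding f_def by (auto dest: filterlim_compose simp: add.commute)
  qed
  \<comment> \<open>Dominating function: the Lipschitz constant bounds every difference quotient,
    and since \<open>h n \<le> 1\<close> all of them vanish outside the ball of radius
    \<open>R + 1\<close>.\<close>
  moreover have "norm (f n x) \<le> L * indicator (cball 0 (R + 1)) x" for n x
  proof (cases "norm x \<le> R + 1")
    case True
    have "\<bar>\<phi> (h n *\<^sub>R b + x) - \<phi> x\<bar> \<le> L * h n"
      using L(2)[of "h n *\<^sub>R b + x" x] h[of n] b by simp
    then show ?thesis
      using True h[of n] by (simp add: f_def abs_divide divide_le_eq)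
  next
    case False
    have "norm (h n *\<^sub>R b) \<le> 1"
      using h[of n] b by simp
    then have "norm (h n *\<^sub>R b + x) > R"
      using False norm_triangle_ineq2[of x "- h n *\<^sub>R b"] by (simp add: add.commute)
    then show ?thesis
      using False by (simp add: f_def R(2))
  qed
  moreover have "integrable lborel (\<lambda>x. L * indicator (cball 0 (R + 1)) x)"
    by (intro integrable_mult_right integrable_real_indicator) (auto simp: emeasure_lborel_cball_finite[unfolded infinity_ennreal_def])
  ultimately have "(\<lambda>n. \<integral>x. f n x \<partial>lborel) \<longlonglongrightarrow> (\<integral>x. frechet_derivative \<phi> (at x) b \<partial>lborel)"
    by (intro integral_dominated_convergence[where w = "\<lambda>x. L * indicator (cball 0 (R + 1)) x"]) auto
  then have "(\<integral>x. frechet_derivative \<phi> (at x) b \<partial>lborel) = 0"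
    unfolding zero by (rule LIMSEQ_unique[OF _ tendsto_const])
  then show ?thesis
    by (simp add: integral_completion)
qed

section \<open>Classical gradients of test functions as weak gradients\<close>

definition gradient :: "('a::euclidean_space \<Rightarrow> real) \<Rightarrow> 'a \<Rightarrow> 'a" where
  "gradient \<phi> x = (\<Sum>b\<in>Basis. frechet_derivative \<phi> (at x) b *\<^sub>R b)"

lemma gradient_inner_Basis: "b \<in> Basis \<Longrightarrow> gradient \<phi> x \<bullet> b = frechet_derivative \<phi> (at x) b"
  by (simp add: gradient_def)

lemma continuous_gradient:
  assumes "test_function UNIV \<phi>"
  shows "continuous_on UNIV (gradient \<phi>)"
  unfolding gradient_def
  by (intro continuous_intros test_functionD(4) test_function_frechet_derivative assms)

lemma gradient_scale:
  assumes "test_function UNIV \<phi>"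
  shows "gradient (\<lambda>x. \<phi> (c *\<^sub>R x)) x = c *\<^sub>R gradient \<phi> (c *\<^sub>R x)"
  by (simp add: gradient_def frechet_derivative_scale[OF assms] scaleR_sum_right)

text \<open>By the Leibniz rule the two integrals sum to the integral of a partial derivative of the
  test function \<open>\<phi> \<psi>\<close>, which is \<open>0\<close>.\<close>

lemma integral_by_parts_test_function:
  fixes \<phi> \<psi> :: "'a::euclidean_space \<Rightarrow> real"
  assumes \<phi>: "test_function UNIV \<phi>" and \<psi>: "test_function UNIV \<psi>" and b: "b \<in> Basis"
  shows "(\<integral>x. \<phi> x * frechet_derivative \<psi> (at x) b \<partial>lebesgue) =
    - (\<integral>x. frechet_derivative \<phi> (at x) b * \<psi> x \<partial>lebesgue)"
proof -
  have "frechet_derivative (\<lambda>x. \<phi> x * \<psi> x) (at x) b =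
      \<phi> x * frechet_derivative \<psi> (at x) b + frechet_derivative \<phi> (at x) b * \<psi> x" for x
    by (simp flip: frechet_derivative_at[OF has_derivative_mult[OF \<phi>[THEN test_functionD(3)] \<psi>[THEN test_functionD(3)]]])
  moreover have "integrable lebesgue (\<lambda>x. \<phi> x * frechet_derivative \<psi> (at x) b)"
    "integrable lebesgue (\<lambda>x. frechet_derivative \<phi> (at x) b * \<psi> x)"
    by (intro integrable_lebesgue_test_function test_function_mult test_function_frechet_derivative \<phi> \<psi> b)+
  ultimately show ?thesis
    using integral_frechet_derivative_eq_0[OF test_function_mult[OF \<phi> \<psi>] b] by simp
qed

lemma weak_gradient_test_function:
  fixes \<phi> :: "'a::euclidean_space \<Rightarrow> real"
  assumes "test_function UNIV \<phi>"
  shows "weak_gradient UNIV \<phi> (gradient \<phi>)"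
  using assms unfolding weak_gradient_def locally_integrable_def lebesgue_on_UNIV_eq
  by (auto simp: gradient_inner_Basis integral_by_parts_test_function
    intro!: integrable_lebesgue_on_continuous test_functionD(4) continuous_gradient)

text \<open>By scaling, the shell \<open>S k\<close> contributes \<open>(q powr a)\<^sup>k\<close> times the contribution of \<open>S 0\<close>: a geometric series.\<close>

lemma nn_integral_shells_finite:
  fixes a q :: real
  defines "S \<equiv> \<lambda>k. {z :: 'a::euclidean_space. q ^ k \<le> norm z \<and> norm z \<le> 2 * q ^ k}"
  assumes q: "0 < q" "q powr a < 1"
  shows "(\<integral>\<^sup>+z. ennreal (norm z powr (a - DIM('a))) * indicator (\<Union>k. S k) z \<partial>lebesgue) < \<infinity>"
proof -
  define g where "g z = ennreal (norm z powr (a - DIM('a)))" for z :: 'a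
  have [measurable]: "g \<in> borel_measurable borel" "S k \<in> sets borel" for k
    unfolding g_def S_def by measurable
  have scale: "(\<integral>\<^sup>+z. g z * indicator (S k) z \<partial>lebesgue) =
      ennreal ((q powr a) ^ k) * (\<integral>\<^sup>+z. g z * indicator (S 0) z \<partial>lebesgue)" for k
  proof -
    define c where "c = q ^ k"
    have c: "0 < c"
      using q by (simp add: c_def)
    have "g (c *\<^sub>R z) * indicator (S k) (c *\<^sub>R z) =
        ennreal (c powr (a - DIM('a))) * (g z * indicator (S 0) z)" for z
      using c by (auto simp: g_def S_def c_def[symmetric] indicator_def powr_mult simp flip: ennreal_mult)
    then have "ennreal (c powr (a - DIM('a))) * (\<integral>\<^sup>+z. g z * indicator (S 0) z \<partial>lebesgue) =
        ennreal (c powr - DIM('a)) * (\<integral>\<^sup>+z. g z * indicator (S k) z \<partial>lebesgue)"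
      using nn_integral_lebesgue_affine[of "\<lambda>z. g z * indicator (S k) z" c 0] c
      by (simp add: nn_integral_cmult nn_integral_completion)
    \<comment> \<open>Multiplication by \<open>c powr N\<close> cancels \<open>c powr (- N)\<close>
      without a division in \<open>ennreal\<close>; the factor \<open>c powr a\<close>
      remains.\<close>
    then have "ennreal (c powr DIM('a)) * (ennreal (c powr (a - DIM('a))) * (\<integral>\<^sup>+z. g z * indicator (S 0) z \<partial>lebesgue)) =
        ennreal (c powr DIM('a)) * (ennreal (c powr - DIM('a)) * (\<integral>\<^sup>+z. g z * indicator (S k) z \<partial>lebesgue))"
      by simp
    then have "(\<integral>\<^sup>+z. g z * indicator (S k) z \<partial>lebesgue) =
        ennreal (c powr a) * (\<integral>\<^sup>+z. g z * indicator (S 0) z \<partial>lebesgue)"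
      using c by (simp add: mult.assoc[symmetric] powr_add[symmetric] flip: ennreal_mult)
    also have "c powr a = (q powr a) ^ k"
      using q by (simp add: c_def powr_realpow[symmetric] powr_powr mult.commute)
    finally show ?thesis .
  qed
  have fin: "(\<integral>\<^sup>+z. g z * indicator (S 0) z \<partial>lebesgue) < \<infinity>"
  proof -
    \<comment> \<open>On the shell \<open>S 0\<close> the norm lies between \<open>1\<close> and
      \<open>2\<close>; the maximum of the two end values covers both signs of the exponent.\<close>
    have "x powr e \<le> max 1 (2 powr e)" if "1 \<le> x" "x \<le> 2" for x e :: real
    proof (cases "0 \<le> e")
      case True
      then show ?thesis using that by (simp add: powr_mono2 le_max_iff_disj)
    next
      case False
      then have "x powr e \<le> 1 powr e" using that by (intro powr_mono2') auto
      then show ?thesis by simp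
    qed
    then have "g z * indicator (S 0) z \<le> ennreal (max 1 (2 powr (a - DIM('a)))) * indicator (cball 0 2) z" for z
      by (auto simp: g_def S_def indicator_def intro!: ennreal_leI)
    then have "(\<integral>\<^sup>+z. g z * indicator (S 0) z \<partial>lebesgue) \<le>
        (\<integral>\<^sup>+z. ennreal (max 1 (2 powr (a - DIM('a)))) * indicator (cball 0 2) (z::'a) \<partial>lborel)"
      by (simp add: nn_integral_completion nn_integral_mono)
    also have "\<dots> < \<infinity>"
      using emeasure_lborel_cball_finite[of "0::'a" 2]
      by (simp add: nn_integral_cmult_indicator ennreal_mult_less_top)
    finally show ?thesis .
  qed
  have "(\<integral>\<^sup>+z. g z * indicator (\<Union>k. S k) z \<partial>lebesgue) \<le> (\<integral>\<^sup>+z. (\<Sum>k. g z * indicator (S k) z) \<partial>lebesgue)"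
  proof (rule nn_integral_mono)
    fix z
    show "g z * indicator (\<Union>k. S k) z \<le> (\<Sum>k. g z * indicator (S k) z)"
    proof (cases "z \<in> (\<Union>k. S k)")
      case True
      then obtain k where "z \<in> S k" by blast
      then have "g z * indicator (\<Union>k. S k) z \<le> sum (\<lambda>k. g z * indicator (S k) z) {k}"
        by (auto simp: indicator_def)
      also have "\<dots> \<le> (\<Sum>k. g z * indicator (S k) z)"
        by (intro sum_le_suminf) auto
      finally show ?thesis .
    qed simp
  qed
  also have "\<dots> = (\<Sum>k. ennreal ((q powr a) ^ k) * (\<integral>\<^sup>+z. g z * indicator (S 0) z \<partial>lebesgue))"
    unfolding scale[symmetric] unfolding nn_integral_completion by (rule nn_integral_suminf) simp
  also have "\<dots> = (\<Sum>k. ennreal ((q powr a) ^ k)) * (\<integral>\<^sup>+z. g z * indicator (S 0) z \<partial>lebesgue)"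
    by (rule ennreal_suminf_multc)
  also have "\<dots> < \<infinity>"
  proof -
    have "summable (\<lambda>k. (q powr a) ^ k)"
      using q by (intro summable_geometric) simp
    then have "(\<Sum>k. ennreal ((q powr a) ^ k)) = ennreal (\<Sum>k. (q powr a) ^ k)"
      by (intro suminf_ennreal2) auto
    then show ?thesis
      using fin by (simp add: ennreal_mult_less_top)
  qed
  finally show ?thesis
    by (simp add: g_def)
qed

text \<open>Dyadic shells with ratio \<open>q = 1 / 2\<close> exhaust the punctured unit ball, and
  the geometric ratio \<open>(1 / 2) powr a\<close> is below \<open>1\<close> because
  \<open>a > 0\<close>. The shell of \<open>z\<close> is found from the least \<open>k\<close> with
  \<open>(1 / 2) ^ k \<le> norm z\<close>.\<close>

lemma nn_integral_norm_powr_ball_finite: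
  fixes a :: real
  assumes "0 < a"
  shows "(\<integral>\<^sup>+z. ennreal (norm z powr (a - DIM('a))) * indicator {z. norm z \<le> 1} (z :: 'a::euclidean_space) \<partial>lebesgue) < \<infinity>"
proof -
  have shell: "\<exists>k. (1 / 2) ^ k \<le> norm z \<and> norm z \<le> 2 * (1 / 2) ^ k" if "norm z \<le> 1" "z \<noteq> 0" for z :: 'a
  proof -
    have "\<exists>k. (1 / 2) ^ k \<le> norm z"
      using real_arch_pow_inv[of "norm z" "1 / 2"] that by (auto intro: less_imp_le)
    then obtain k where *: "(1 / 2) ^ k \<le> norm z" "\<And>j. j < k \<Longrightarrow> \<not> (1 / 2) ^ j \<le> norm z"
      by (subst (asm) exists_least_iff) blast
    show ?thesis
    proof (cases k)
      case (Suc j)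
      then have "norm z < (1 / 2) ^ j"
        using *(2)[of j] by simp
      then show ?thesis
        using *(1) Suc by (intro exI[of _ k]) auto
    qed (use that * in \<open>auto intro!: exI[of _ 0]\<close>)
  qed
  have "(\<integral>\<^sup>+z. ennreal (norm z powr (a - DIM('a))) * indicator {z. norm z \<le> 1} (z :: 'a) \<partial>lebesgue)
      \<le> (\<integral>\<^sup>+z. ennreal (norm z powr (a - DIM('a))) *
        indicator (\<Union>k. {z :: 'a. (1 / 2) ^ k \<le> norm z \<and> norm z \<le> 2 * (1 / 2) ^ k}) z \<partial>lebesgue)"
  proof (intro nn_integral_mono)
    fix z :: 'a
    show "ennreal (norm z powr (a - DIM('a))) * indicator {z. norm z \<le> 1} z \<le>
        ennreal (norm z powr (a - DIM('a))) *
        indicator (\<Union>k. {z. (1 / 2) ^ k \<le> norm z \<and> norm z \<le> 2 * (1 / 2) ^ k}) z"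
    \<comment> \<open>The origin lies in no shell, but the integrand is \<open>0\<close> there by
      the convention \<open>0 powr e = 0\<close>.\<close>
    proof (cases "norm z \<le> 1 \<and> z \<noteq> 0")
      case True
      then have "z \<in> (\<Union>k. {z. (1 / 2) ^ k \<le> norm z \<and> norm z \<le> 2 * (1 / 2) ^ k})"
        using shell[of z] by blast
      then show ?thesis
        using True by simp
    qed auto
  qed
  also have "\<dots> < \<infinity>"
    using assms by (intro nn_integral_shells_finite) (use powr_less_mono2[of a "1 / 2" 1] in auto)
  finally show ?thesis .
qed

text \<open>The counterpart with ratio \<open>q = 2\<close>: the shells grow to infinity, and
  \<open>2 powr a < 1\<close> because \<open>a < 0\<close>.\<close>

lemma nn_integral_norm_powr_outside_finite:
  fixes a :: real
  assumes "a < 0"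
  shows "(\<integral>\<^sup>+z. ennreal (norm z powr (a - DIM('a))) * indicator {z. 1 \<le> norm z} (z :: 'a::euclidean_space) \<partial>lebesgue) < \<infinity>"
proof -
  have shell: "\<exists>k. 2 ^ k \<le> norm z \<and> norm z \<le> 2 * 2 ^ k" if "1 \<le> norm z" for z :: 'a
  proof -
    have "\<exists>k. norm z \<le> 2 * 2 ^ k"
    proof -
      obtain n where "norm z < 2 ^ n"
        using real_arch_pow[of 2 "norm z"] by auto
      then have "norm z \<le> 2 * 2 ^ n"
        using norm_ge_zero[of z] by linarith
      then show ?thesis ..
    qed
    then obtain k where *: "norm z \<le> 2 * 2 ^ k" "\<And>j. j < k \<Longrightarrow> \<not> norm z \<le> 2 * 2 ^ j"
      by (subst (asm) exists_least_iff) blast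
    show ?thesis
    proof (cases k)
      case (Suc j)
      then have "2 * 2 ^ j < norm z"
        using *(2)[of j] by simp
      then show ?thesis
        using *(1) Suc by (intro exI[of _ k]) auto
    qed (use that * in \<open>auto intro!: exI[of _ 0]\<close>)
  qed
  have sub: "{z. 1 \<le> norm z} \<subseteq> (\<Union>k. {z :: 'a. 2 ^ k \<le> norm z \<and> norm z \<le> 2 * 2 ^ k})"
    using shell by blast
  have "(\<integral>\<^sup>+z. ennreal (norm z powr (a - DIM('a))) * indicator {z. 1 \<le> norm z} (z :: 'a) \<partial>lebesgue)
      \<le> (\<integral>\<^sup>+z. ennreal (norm z powr (a - DIM('a))) *
        indicator (\<Union>k. {z :: 'a. 2 ^ k \<le> norm z \<and> norm z \<le> 2 * 2 ^ k}) z \<partial>lebesgue)"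
    by (intro nn_integral_mono mult_left_mono) (use sub in \<open>auto simp: indicator_def\<close>)
  also have "\<dots> < \<infinity>"
    using assms by (intro nn_integral_shells_finite) (auto simp: powr_less_one)
  finally show ?thesis .
qed

subsection \<open>Scaling of Lebesgue and Gagliardo seminorms\<close>

lemma Lp_norm_lebesgue:
  "Lp_norm UNIV q f = ennpowr (\<integral>\<^sup>+x. ennreal (norm (f x) powr q) \<partial>lebesgue) (1 / q)"
  by (simp add: Lp_norm_def lebesgue_on_UNIV_eq)

lemma borel_measurable_norm_powr:
  fixes f :: "'a::euclidean_space \<Rightarrow> 'b::real_normed_vector"
  assumes "continuous_on UNIV f"
  shows "(\<lambda>x. ennreal (norm (f x) powr q)) \<in> borel_measurable borel"
proof -
  have "(\<lambda>x. norm (f x)) \<in> borel_measurable borel"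
    using assms by (intro borel_measurable_continuous_onI continuous_intros)
  then show ?thesis by measurable
qed

lemma Lp_norm_scale:
  fixes f :: "'a::euclidean_space \<Rightarrow> 'b::real_normed_vector"
  assumes "continuous_on UNIV f" "0 < c"
  shows "Lp_norm UNIV q (\<lambda>x. f (c *\<^sub>R x)) = ennreal (c powr (- (real DIM('a) / q))) * Lp_norm UNIV q f"
proof -
  have "(\<integral>\<^sup>+x. ennreal (norm (f (c *\<^sub>R x)) powr q) \<partial>lebesgue) =
      ennreal (c powr - real DIM('a)) * (\<integral>\<^sup>+x. ennreal (norm (f x) powr q) \<partial>lebesgue)"
    using nn_integral_lebesgue_affine[OF borel_measurable_norm_powr[OF assms(1)], of c 0 q] assms(2) by simp
  then show ?thesis
    using assms(2) by (simp add: Lp_norm_lebesgue ennpowr_cmult powr_powr)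
qed

lemma Lp_norm_scaleR:
  fixes f :: "'a::euclidean_space \<Rightarrow> 'b::real_normed_vector"
  assumes "continuous_on UNIV f" "0 < c" "0 < q"
  shows "Lp_norm UNIV q (\<lambda>x. c *\<^sub>R f x) = ennreal c * Lp_norm UNIV q f"
proof -
  have "(\<integral>\<^sup>+x. ennreal (norm (c *\<^sub>R f x) powr q) \<partial>lebesgue) =
      (\<integral>\<^sup>+x. ennreal (c powr q) * ennreal (norm (f x) powr q) \<partial>lebesgue)"
    using assms by (simp add: powr_mult ennreal_mult)
  also have "\<dots> = ennreal (c powr q) * (\<integral>\<^sup>+x. ennreal (norm (f x) powr q) \<partial>lebesgue)"
    using borel_measurable_norm_powr[OF assms(1)] by (simp add: nn_integral_completion nn_integral_cmult)
  finally show ?thesis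
    using assms by (simp add: Lp_norm_lebesgue ennpowr_cmult powr_powr)
qed

lemma Lp_norm_finite:
  fixes f :: "'a::euclidean_space \<Rightarrow> 'b::real_normed_vector"
  assumes "continuous_on UNIV f" "\<And>x. R < norm x \<Longrightarrow> f x = 0" "0 < q"
  shows "Lp_norm UNIV q f < \<infinity>"
proof -
  have "compact (f ` cball 0 R)"
    by (intro compact_continuous_image compact_cball continuous_on_subset[OF assms(1)]) auto
  then obtain M where M: "\<And>x. norm x \<le> R \<Longrightarrow> norm (f x) \<le> M"
    by (force simp: bounded_iff dest: compact_imp_bounded)
  have "ennreal (norm (f x) powr q) \<le> ennreal (M powr q) * indicator (cball 0 R) x" for x
    using M[of x] assms(2)[of x] assms(3)
    by (cases "norm x \<le> R") (auto simp: indicator_def intro!: ennreal_leI powr_mono2)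
  then have "(\<integral>\<^sup>+x. ennreal (norm (f x) powr q) \<partial>lebesgue) \<le>
      (\<integral>\<^sup>+x. ennreal (M powr q) * indicator (cball 0 R) (x :: 'a) \<partial>lborel)"
    by (simp add: nn_integral_completion nn_integral_mono)
  also have "\<dots> < \<infinity>"
    using emeasure_lborel_cball_finite[of "0::'a" R]
    by (simp add: nn_integral_cmult_indicator ennreal_mult_less_top)
  finally show ?thesis
    unfolding Lp_norm_lebesgue by (rule ennpowr_less_top)
qed

lemma open_Collect_neq_continuous:
  fixes f g :: "'a::topological_space \<Rightarrow> 'b::real_normed_vector"
  assumes "continuous_on UNIV f" "continuous_on UNIV g"
  shows "open {x. f x \<noteq> g x}"
proof -
  have "closed {x. f x = g x}"
    using assms by (rule closed_Collect_eq)
  then show ?thesis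
    by (simp add: closed_def Collect_neg_eq)
qed

lemma Lp_norm_pos:
  fixes f :: "'a::euclidean_space \<Rightarrow> 'b::real_normed_vector"
  assumes "continuous_on UNIV f" "f x0 \<noteq> 0"
  shows "0 < Lp_norm UNIV q f"
  unfolding Lp_norm_lebesgue
proof (intro ennpowr_pos nn_integral_lebesgue_pos[where S = "{x. f x \<noteq> 0}"])
  show "open {x. f x \<noteq> 0}"
    using assms(1) by (rule open_Collect_neq_continuous) simp
qed (use assms borel_measurable_norm_powr[OF assms(1)] in auto)

text \<open>The double integral is stripped of its constant and of the outer root, and the kernel
  exponent \<open>e\<close> is left free, so that its homogeneity \<open>e - 2 N\<close> can be read
  off; the case of interest is \<open>e = N + s q\<close>.\<close>

definition gagliardo :: "real \<Rightarrow> real \<Rightarrow> ('a::euclidean_space \<Rightarrow> real) \<Rightarrow> ennreal" where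
  "gagliardo e q u = (\<integral>\<^sup>+(x, y). ennreal (\<bar>u x - u y\<bar> powr q / norm (x - y) powr e) \<partial>lebesgue)"

lemma sobolev_seminorm_gagliardo:
  fixes u :: "'a::euclidean_space \<Rightarrow> real"
  assumes "0 < s" "s < 1"
  shows "sobolev_seminorm UNIV s q u =
    ennpowr (ennreal (gagliardo_const DIM('a) s q) * gagliardo (real DIM('a) + s * q) q u) (1 / q)"
  using assms by (simp add: sobolev_seminorm_def gagliardo_def lebesgue_on_UNIV_eq)

text \<open>Since \<open>p + N \<ge> 2\<close> and \<open>p s > 0\<close>, the Gamma function in the
  numerator has a positive argument; the one in the denominator does because
  \<open>s < 1\<close>.\<close>

lemma gagliardo_const_pos:
  assumes "0 < s" "s < 1" "1 \<le> p" "0 < N"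
  shows "0 < gagliardo_const N s p"
proof -
  have "0 < p * s"
    using assms by simp
  then have "0 < p * s + p + real N - 2"
    using assms(3,4) by linarith
  then show ?thesis
    using assms by (simp add: gagliardo_const_def Gamma_real_pos)
qed

lemma borel_measurable_gagliardo_integrand:
  fixes u :: "'a::euclidean_space \<Rightarrow> real"
  assumes [measurable]: "u \<in> borel_measurable borel"
  shows "(\<lambda>(x, y). ennreal (\<bar>u x - u y\<bar> powr q / norm (x - y) powr e)) \<in> borel_measurable (borel :: ('a \<times> 'a) measure)"
  unfolding borel_prod[symmetric] by measurable

text \<open>The pair \<open>(x, y)\<close> is dilated as one point of a space of dimension
  \<open>2 N\<close>, which gives \<open>c powr (- 2 N)\<close>; the kernel contributes
  \<open>c powr e\<close>.\<close>

lemma gagliardo_scale: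
  fixes u :: "'a::euclidean_space \<Rightarrow> real"
  assumes u: "u \<in> borel_measurable borel" and c: "0 < c"
  shows "gagliardo e q (\<lambda>x. u (c *\<^sub>R x)) = ennreal (c powr (e - 2 * real DIM('a))) * gagliardo e q u"
proof -
  define F where "F = (\<lambda>(x, y). ennreal (\<bar>u x - u y\<bar> powr q / norm (x - y) powr e))"
  have [measurable]: "F \<in> borel_measurable borel"
    unfolding F_def by (rule borel_measurable_gagliardo_integrand[OF u])
  have "(\<lambda>(x, y). ennreal (\<bar>u (c *\<^sub>R x) - u (c *\<^sub>R y)\<bar> powr q / norm (x - y) powr e)) z =
      ennreal (c powr e) * F (0 + c *\<^sub>R z)" for z
    using c by (auto simp: F_def split_beta powr_mult simp flip: ennreal_mult scaleR_diff_right)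
  then have "gagliardo e q (\<lambda>x. u (c *\<^sub>R x)) = (\<integral>\<^sup>+z. ennreal (c powr e) * F (0 + c *\<^sub>R z) \<partial>lebesgue)"
    unfolding gagliardo_def by (intro nn_integral_cong) auto
  also have "\<dots> = ennreal (c powr e) * (\<integral>\<^sup>+z. F (0 + c *\<^sub>R z) \<partial>lebesgue)"
    by (simp add: nn_integral_completion nn_integral_cmult)
  also have "\<dots> = ennreal (c powr e) * (ennreal (c powr - real DIM('a \<times> 'a)) * gagliardo e q u)"
    using c nn_integral_lebesgue_affine[of F c 0] by (simp add: gagliardo_def flip: F_def)
  also have "\<dots> = ennreal (c powr (e - 2 * real DIM('a))) * gagliardo e q u"
    using c by (simp add: mult.assoc[symmetric] powr_add[symmetric] flip: ennreal_mult)
  finally show ?thesis .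
qed

lemma gagliardo_pos:
  fixes u :: "'a::euclidean_space \<Rightarrow> real"
  assumes u: "continuous_on UNIV u" and "u x0 \<noteq> u y0"
  shows "0 < gagliardo e q u"
  unfolding gagliardo_def
proof (rule nn_integral_lebesgue_pos[where S = "{z. u (fst z) \<noteq> u (snd z)}"])
  show "open {z. u (fst z) \<noteq> u (snd z)}"
    by (rule open_Collect_neq_continuous) (auto intro!: continuous_on_compose2[OF u] continuous_intros)
  show "(\<lambda>(x, y). ennreal (\<bar>u x - u y\<bar> powr q / norm (x - y) powr e)) \<in> borel_measurable borel"
    by (intro borel_measurable_gagliardo_integrand borel_measurable_continuous_onI u)
  have "(x0, y0) \<in> {z. u (fst z) \<noteq> u (snd z)}"
    using assms(2) by simp
  then show "{z. u (fst z) \<noteq> u (snd z)} \<noteq> {}"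
    by blast
qed (auto simp: split_beta)

text \<open>On the unit ball the integrand is at most \<open>L powr q\<close> times the norm to the
  power \<open>q (1 - s) - N\<close>, integrable as \<open>s < 1\<close>. Outside it is at most
  \<open>M powr q\<close> times the norm to the power \<open>- s q - N\<close>, integrable as
  \<open>s > 0\<close>.\<close>

lemma gagliardo_kernel_finite:
  fixes L M q s :: real
  assumes "0 < s" "s < 1" "1 \<le> q" "0 < L" "0 < M"
  shows "(\<integral>\<^sup>+z. ennreal (min (L * norm z) M powr q / norm z powr (real DIM('a) + s * q)) \<partial>lebesgue :: 'a::euclidean_space measure) < \<infinity>"
proof -
  define g where "g a z = ennreal (norm z powr (a - DIM('a)))" for a :: real and z :: 'a
  have [measurable]: "g a \<in> borel_measurable borel" for a
    unfolding g_def by measurable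
  have bound: "ennreal (min (L * norm z) M powr q / norm z powr (real DIM('a) + s * q)) \<le>
      ennreal (L powr q) * (g (q - s * q) z * indicator {z. norm z \<le> 1} z) +
      ennreal (M powr q) * (g (- (s * q)) z * indicator {z. 1 \<le> norm z} z)" for z :: 'a
  proof (cases "z = 0")
    case False
    have div: "x * norm z powr r / norm z powr (real DIM('a) + s * q) =
        x * norm z powr (r - s * q - DIM('a))" for x r
      by (simp add: powr_diff powr_add)
    show ?thesis
    proof (cases "norm z \<le> 1")
      case True
      have "min (L * norm z) M powr q / norm z powr (real DIM('a) + s * q) \<le>
          (L * norm z) powr q / norm z powr (real DIM('a) + s * q)"
        using assms by (intro divide_right_mono powr_mono2) auto
      also have "\<dots> = L powr q * norm z powr (q - s * q - DIM('a))"
        using assms by (simp add: powr_mult div)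
      finally have "ennreal (min (L * norm z) M powr q / norm z powr (real DIM('a) + s * q)) \<le>
          ennreal (L powr q) * (g (q - s * q) z * indicator {z. norm z \<le> 1} z)"
        using True by (simp add: g_def ennreal_leI flip: ennreal_mult)
      then show ?thesis
        by (rule order_trans) simp
    next
      case outside: False
      have "min (L * norm z) M powr q / norm z powr (real DIM('a) + s * q) \<le>
          M powr q * norm z powr 0 / norm z powr (real DIM('a) + s * q)"
        using assms False by (intro divide_right_mono) (auto intro!: powr_mono2)
      also have "\<dots> = M powr q * norm z powr (- (s * q) - DIM('a))"
        using div[of "M powr q" 0] by simp
      finally have "ennreal (min (L * norm z) M powr q / norm z powr (real DIM('a) + s * q)) \<le>
          ennreal (M powr q) * (g (- (s * q)) z * indicator {z. 1 \<le> norm z} z)"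
        using outside by (simp add: g_def ennreal_leI flip: ennreal_mult)
      then show ?thesis
        by (rule order_trans) simp
    qed
  qed simp
  have "s * q < q"
    using assms by simp
  then have "(\<integral>\<^sup>+z. g (q - s * q) z * indicator {z. norm z \<le> 1} z \<partial>lebesgue) < \<infinity>"
    "(\<integral>\<^sup>+z. g (- (s * q)) z * indicator {z. 1 \<le> norm z} z \<partial>lebesgue) < \<infinity>"
    unfolding g_def using assms
    by (auto intro!: nn_integral_norm_powr_ball_finite nn_integral_norm_powr_outside_finite simp del: infinity_ennreal_def)
  then have "(\<integral>\<^sup>+z. ennreal (L powr q) * (g (q - s * q) z * indicator {z. norm z \<le> 1} z) +
      ennreal (M powr q) * (g (- (s * q)) z * indicator {z. 1 \<le> norm z} z) \<partial>lebesgue) < \<infinity>"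
    unfolding nn_integral_completion
    by (simp add: nn_integral_add nn_integral_cmult ennreal_mult_less_top)
  then show ?thesis
    using nn_integral_mono[OF bound] by (rule le_less_trans[rotated])
qed

text \<open>The increment of \<open>u\<close> is at most \<open>min (L |x - y|) (2 M)\<close>, and
  it vanishes unless \<open>x\<close> or \<open>y\<close> lies in the supporting ball
  \<open>K\<close>. By Tonelli each of the two alternatives contributes at most \<open>W\<close>
  times the volume of \<open>K\<close>, where \<open>W\<close> is the integral of the kernel
  above.\<close>

lemma gagliardo_finite:
  fixes u :: "'a::euclidean_space \<Rightarrow> real"
  assumes u: "test_function UNIV u" and s: "0 < s" "s < 1" and q: "1 \<le> q"
  shows "gagliardo (real DIM('a) + s * q) q u < \<infinity>"
proof -
  obtain L where L: "0 < L" "\<And>x y. \<bar>u x - u y\<bar> \<le> L * norm (x - y)"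
    using test_function_lipschitz[OF u] by blast
  obtain M where M: "0 < M" "\<And>x. \<bar>u x\<bar> \<le> M"
    using test_function_bounded[OF u] by blast
  obtain R where R: "0 < R" "\<And>x. R < norm x \<Longrightarrow> u x = 0"
    using test_function_support[OF u] by blast
  define e where "e = real DIM('a) + s * q"
  define w where "w z = ennreal (min (L * norm z) (2 * M) powr q / norm z powr e)" for z :: 'a
  define W where "W = (\<integral>\<^sup>+z. w z \<partial>lborel)"
  have W: "W < \<infinity>"
    using gagliardo_kernel_finite[OF s q L(1), of "2 * M"] M(1)
    unfolding W_def w_def e_def nn_integral_completion by simp
  have [measurable]: "w \<in> borel_measurable borel"
    unfolding w_def by measurable
  let ?K = "cball (0::'a) R"
  have bound: "ennreal (\<bar>u x - u y\<bar> powr q / norm (x - y) powr e) \<le>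
      indicator ?K x * w (x - y) + indicator ?K y * w (x - y)" for x y
  proof -
    have "ennreal (\<bar>u x - u y\<bar> powr q / norm (x - y) powr e) \<le> w (x - y)"
    proof -
      have "\<bar>u x - u y\<bar> \<le> min (L * norm (x - y)) (2 * M)"
        using L(2)[of x y] M(2)[of x] M(2)[of y] by simp
      then show ?thesis
        using q unfolding w_def by (intro ennreal_leI divide_right_mono powr_mono2) auto
    qed
    moreover have "u x - u y = 0" if "x \<notin> ?K" "y \<notin> ?K"
      using R(2)[of x] R(2)[of y] that by simp
    ultimately show ?thesis
      by (auto simp: indicator_def add_increasing2)
  qed
  have int1: "(\<integral>\<^sup>+y. w (x - y) \<partial>lborel) = W" for x
    using nn_integral_lebesgue_affine[of w "-1" x] by (simp add: nn_integral_completion W_def)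
  have int2: "(\<integral>\<^sup>+x. w (x - y) \<partial>lborel) = W" for y
    using nn_integral_lebesgue_affine[of w 1 "- y"] by (simp add: nn_integral_completion W_def)
  define f where "f = (\<lambda>z. indicator ?K (fst z) * w (fst z - snd z))"
  define g where "g = (\<lambda>z. indicator ?K (snd z) * w (fst z - snd z))"
  have fg [measurable]: "f \<in> borel_measurable (lborel \<Otimes>\<^sub>M lborel)" "g \<in> borel_measurable (lborel \<Otimes>\<^sub>M lborel)"
  proof -
    have ind: "(indicator ?K :: 'a \<Rightarrow> ennreal) \<in> borel_measurable lborel"
      by (rule borel_measurable_indicator) simp
    have proj: "fst \<in> borel_measurable (lborel \<Otimes>\<^sub>M lborel :: ('a \<times> 'a) measure)"
      "snd \<in> borel_measurable (lborel \<Otimes>\<^sub>M lborel :: ('a \<times> 'a) measure)"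
      by (simp_all cong: measurable_cong_sets)
    have diff: "(\<lambda>z. w (fst z - snd z)) \<in> borel_measurable (lborel \<Otimes>\<^sub>M lborel)"
      by (rule measurable_compose[OF borel_measurable_diff[OF proj]]) simp
    show "f \<in> borel_measurable (lborel \<Otimes>\<^sub>M lborel)" "g \<in> borel_measurable (lborel \<Otimes>\<^sub>M lborel)"
      unfolding f_def g_def
      by (intro borel_measurable_times_ennreal diff
          measurable_compose[OF measurable_fst ind] measurable_compose[OF measurable_snd ind])+
  qed
  have "gagliardo e q u \<le> (\<integral>\<^sup>+z. f z + g z \<partial>lebesgue)"
    unfolding gagliardo_def f_def g_def using bound by (intro nn_integral_mono) auto
  also have "\<dots> = (\<integral>\<^sup>+z. f z + g z \<partial>(lborel \<Otimes>\<^sub>M lborel))"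
    by (simp add: nn_integral_completion lborel_prod)
  also have "\<dots> = (\<integral>\<^sup>+z. f z \<partial>(lborel \<Otimes>\<^sub>M lborel)) + (\<integral>\<^sup>+z. g z \<partial>(lborel \<Otimes>\<^sub>M lborel))"
    by (rule nn_integral_add) measurable
  also have "(\<integral>\<^sup>+z. f z \<partial>(lborel \<Otimes>\<^sub>M lborel)) = (\<integral>\<^sup>+x. \<integral>\<^sup>+y. f (x, y) \<partial>lborel \<partial>lborel)"
    by (rule lborel.nn_integral_fst[symmetric]) measurable
  also have "\<dots> = W * emeasure lborel ?K"
    by (simp add: f_def nn_integral_cmult int1 mult.commute[of _ W] nn_integral_cmult_indicator)
  also have "(\<integral>\<^sup>+z. g z \<partial>(lborel \<Otimes>\<^sub>M lborel)) = (\<integral>\<^sup>+y. \<integral>\<^sup>+x. g (x, y) \<partial>lborel \<partial>lborel)"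
    by (rule lborel_pair.nn_integral_snd[symmetric]) measurable
  also have "\<dots> = W * emeasure lborel ?K"
    by (simp add: g_def nn_integral_cmult int2 mult.commute[of _ W] nn_integral_cmult_indicator)
  finally show ?thesis
    using W emeasure_lborel_cball_finite[of "0::'a" R]
    by (auto simp: e_def ennreal_mult_less_top elim!: le_less_trans)
qed

subsection \<open>Two-sided bounds for Sobolev seminorms\<close>

text \<open>The fractional exponent is \<open>(N + s q - 2 N) / q = s - N / q\<close>. The order
  \<open>s = 1\<close>, where the seminorm is an infimum, is treated by separate upper and lower
  bounds below.\<close>

lemma sobolev_seminorm_scale:
  fixes u :: "'a::euclidean_space \<Rightarrow> real"
  assumes u: "continuous_on UNIV u" and c: "0 < c" and s: "0 \<le> s" "s < 1" and q: "0 < q"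
  shows "sobolev_seminorm UNIV s q (\<lambda>x. u (c *\<^sub>R x)) =
    ennreal (c powr (s - real DIM('a) / q)) * sobolev_seminorm UNIV s q u"
proof (cases "s = 0")
  case True
  then show ?thesis
    using Lp_norm_scale[OF u c] by (simp add: sobolev_seminorm_def)
next
  case False
  then have s': "0 < s"
    using s by simp
  have [measurable]: "u \<in> borel_measurable borel"
    using u by (rule borel_measurable_continuous_onI)
  have "(s * q - real DIM('a)) * (1 / q) = s - real DIM('a) / q"
    using q by (simp add: field_simps)
  moreover have "real DIM('a) + s * q - 2 * real DIM('a) = s * q - real DIM('a)"
    by simp
  ultimately show ?thesis
    using c by (simp add: sobolev_seminorm_gagliardo[OF s' s(2)] gagliardo_scale mult.left_commute[of "ennreal _" "ennreal (c powr _)"]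
      ennpowr_cmult powr_powr)
qed

text \<open>For \<open>s = 1\<close> the classical gradient of the dilated function competes in the
  infimum; the chain rule gives a factor \<open>c\<close> and the \<open>L^q\<close> norm a factor
  \<open>c powr (- (N / q))\<close>. For \<open>s < 1\<close> finiteness at \<open>c = 1\<close> and
  exact scaling suffice.\<close>

lemma sobolev_seminorm_test_function_le:
  fixes u :: "'a::euclidean_space \<Rightarrow> real"
  assumes u: "test_function UNIV u" and s: "0 \<le> s" "s \<le> 1" and q: "1 \<le> q"
  obtains A where "0 < A"
    "\<And>c. 0 < c \<Longrightarrow> sobolev_seminorm UNIV s q (\<lambda>x. u (c *\<^sub>R x)) \<le> ennreal (A * c powr (s - real DIM('a) / q))"
proof -
  note cont = test_functionD(4)[OF u]
  obtain R where R: "0 < R" "\<And>x. R < norm x \<Longrightarrow> u x = 0"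
    using test_function_support[OF u] by blast
  obtain B where B: "B < \<infinity>"
    "\<And>c. 0 < c \<Longrightarrow> sobolev_seminorm UNIV s q (\<lambda>x. u (c *\<^sub>R x)) \<le> ennreal (c powr (s - real DIM('a) / q)) * B"
  proof (cases "s = 1")
    case True
    have "gradient u x = 0" if "R < norm x" for x
      using frechet_derivative_eq_0_outside[of R u x] R(2) that by (simp add: gradient_def)
    then have fin: "Lp_norm UNIV q (gradient u) < \<infinity>"
      using q by (intro Lp_norm_finite[of _ R] continuous_gradient[OF u]) auto
    have "sobolev_seminorm UNIV s q (\<lambda>x. u (c *\<^sub>R x)) \<le>
        ennreal (c powr (s - real DIM('a) / q)) * Lp_norm UNIV q (gradient u)" if c: "0 < c" for c
    proof -
      have "sobolev_seminorm UNIV s q (\<lambda>x. u (c *\<^sub>R x)) \<le> Lp_norm UNIV q (gradient (\<lambda>x. u (c *\<^sub>R x)))"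
        using True weak_gradient_test_function[OF test_function_scale[OF u c]]
        by (auto simp: sobolev_seminorm_def intro: INF_lower2)
      also have "gradient (\<lambda>x. u (c *\<^sub>R x)) = (\<lambda>x. c *\<^sub>R gradient u (c *\<^sub>R x))"
        using gradient_scale[OF u] by blast
      also have "Lp_norm UNIV q \<dots> = ennreal c * Lp_norm UNIV q (\<lambda>x. gradient u (c *\<^sub>R x))"
        using c q by (intro Lp_norm_scaleR continuous_on_compose2[OF continuous_gradient[OF u]] continuous_intros) auto
      also have "\<dots> = ennreal (c powr (s - real DIM('a) / q)) * Lp_norm UNIV q (gradient u)"
        using c True
        by (simp add: Lp_norm_scale[OF continuous_gradient[OF u]] mult.assoc[symmetric]
          powr_mult_base flip: ennreal_mult)
      finally show ?thesis .
    qed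
    with fin show ?thesis by (rule that)
  next
    case False
    then have s1: "s < 1"
      using s by simp
    have "sobolev_seminorm UNIV s q u < \<infinity>"
    proof (cases "s = 0")
      case True
      then show ?thesis
        using q R(2) Lp_norm_finite[of u R q, OF cont] by (simp add: sobolev_seminorm_def)
    next
      case False
      then have "0 < s"
        using s by simp
      then show ?thesis
        using gagliardo_finite[OF u _ s1 q]
        by (simp add: sobolev_seminorm_gagliardo[OF _ s1] ennreal_mult_less_top ennpowr_less_top[simplified])
    qed
    then show ?thesis
      using sobolev_seminorm_scale[OF cont _ s(1) s1, of _ q] q by (intro that) auto
  qed
  obtain r where r: "0 \<le> r" "B = ennreal r"
    using B(1) by (cases B) auto
  show ?thesis
  \<comment> \<open>The bound \<open>r\<close> itself is \<open>0\<close> when \<open>u\<close>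
    vanishes, whereas the constant is promised to be positive.\<close>
  proof (rule that[of "r + 1"])
    fix c :: real
    assume "0 < c"
    then have "sobolev_seminorm UNIV s q (\<lambda>x. u (c *\<^sub>R x)) \<le> ennreal (c powr (s - real DIM('a) / q) * r)"
      using B(2)[of c] r by (simp add: ennreal_mult)
    also have "\<dots> \<le> ennreal ((r + 1) * c powr (s - real DIM('a) / q))"
      by (intro ennreal_leI) (simp add: algebra_simps)
    finally show "sobolev_seminorm UNIV s q (\<lambda>x. u (c *\<^sub>R x)) \<le> ennreal ((r + 1) * c powr (s - real DIM('a) / q))" .
  qed (use r in simp)
qed

text \<open>Otherwise \<open>u\<close> is constant on the line through \<open>x0\<close> in
  direction \<open>b\<close>, and this line leaves the support: moving by
  \<open>norm x0 + R + 1\<close> reaches norm at least \<open>R + 1\<close>.\<close>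

lemma frechet_derivative_test_function_nonzero:
  fixes u :: "'a::euclidean_space \<Rightarrow> real"
  assumes u: "test_function UNIV u" and x0: "u x0 \<noteq> 0" and b: "b \<in> Basis"
  shows "\<exists>x. frechet_derivative u (at x) b \<noteq> 0"
proof (rule ccontr)
  assume "\<not> ?thesis"
  then have zero: "frechet_derivative u (at x) b = 0" for x
    by blast
  have "((\<lambda>t. u (x0 + t *\<^sub>R b)) has_real_derivative 0) (at t)" for t
  proof -
    have "((\<lambda>t. u (x0 + t *\<^sub>R b)) has_derivative (\<lambda>h. frechet_derivative u (at (x0 + t *\<^sub>R b)) (h *\<^sub>R b))) (at t)"
      by (rule has_derivative_compose[where f = "\<lambda>t. x0 + t *\<^sub>R b"])
        (auto intro!: derivative_eq_intros test_functionD(3)[OF u])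
    moreover have "(*) (0::real) = (\<lambda>_. 0)"
      by auto
    ultimately show ?thesis
      using linear_scale[OF has_derivative_linear[OF test_functionD(3)[OF u]]] zero
      by (simp add: has_field_derivative_def)
  qed
  then have const: "u (x0 + t *\<^sub>R b) = u (x0 + 0 *\<^sub>R b)" for t
    by (intro DERIV_isconst_all allI)
  obtain R where R: "0 < R" "\<And>x. R < norm x \<Longrightarrow> u x = 0"
    using test_function_support[OF u] by blast
  have "norm (x0 + (norm x0 + R + 1) *\<^sub>R b) \<ge> norm ((norm x0 + R + 1) *\<^sub>R b) - norm x0"
    using norm_triangle_ineq2[of "(norm x0 + R + 1) *\<^sub>R b" "- x0"] by (simp add: add.commute)
  then have "R < norm (x0 + (norm x0 + R + 1) *\<^sub>R b)"
    using b R(1) by simp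
  then have "u (x0 + (norm x0 + R + 1) *\<^sub>R b) = 0"
    by (rule R(2))
  with const x0 show False
    by simp
qed

text \<open>
  Tests the weak gradient of \<open>u (c x)\<close> with \<open>\<psi> (c x)\<close>, where \<open>\<psi>\<close> is a partial derivative of \<open>u\<close>.
  Instead of Hoelder's inequality, \<open>\<bar>G\<bar> \<le> \<epsilon> + \<epsilon>\<^sup>1\<^sup>-\<^sup>q \<bar>G\<bar>\<^sup>q\<close> with \<open>\<epsilon> = c \<delta>\<close>, where \<open>\<delta>\<close> makes the first term
  absorb exactly half of the left-hand side.
\<close>

lemma weak_gradient_scale_lower_bound:
  fixes u :: "'a::euclidean_space \<Rightarrow> real"
  assumes u: "test_function UNIV u" and x0: "u x0 \<noteq> 0" and q: "1 \<le> q"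
  obtains A where "0 < A"
    "\<And>c G. 0 < c \<Longrightarrow> weak_gradient UNIV (\<lambda>x. u (c *\<^sub>R x)) G \<Longrightarrow>
      ennreal (A * c powr (1 - real DIM('a) / q)) \<le> Lp_norm UNIV q G"
proof -
  define b where "b = (SOME b. b \<in> (Basis :: 'a set))"
  have b: "b \<in> Basis"
    unfolding b_def by (rule SOME_Basis)
  define \<psi> where "\<psi> x = frechet_derivative u (at x) b" for x
  have \<psi>: "test_function UNIV \<psi>"
    unfolding \<psi>_def by (rule test_function_frechet_derivative[OF u b])
  obtain x1 where x1: "\<psi> x1 \<noteq> 0"
    using frechet_derivative_test_function_nonzero[OF u x0 b] by (auto simp: \<psi>_def)
  \<comment> \<open>Integration by parts turns \<open>I\<close> into minus the integral of
    \<open>\<psi>\<close> squared, so \<open>I\<close> is nonzero. Testing with a derivative of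
    \<open>u\<close> itself is chosen for this reason.\<close>
  define I where "I = (\<integral>x. u x * frechet_derivative \<psi> (at x) b \<partial>lebesgue)"
  have "0 < (\<integral>x. \<psi> x * \<psi> x \<partial>lebesgue)"
  proof -
    have "0 < (\<integral>\<^sup>+x. ennreal (\<psi> x * \<psi> x) \<partial>lebesgue)"
      using x1 borel_measurable_test_function[OF \<psi>]
      by (intro nn_integral_lebesgue_pos[of _ "{x. \<psi> x \<noteq> 0}"] open_Collect_neq_continuous test_functionD(4)[OF \<psi>])
        (auto simp: not_le mult_le_0_iff)
    then show ?thesis
      by (subst (asm) nn_integral_eq_integral) (auto intro!: integrable_lebesgue_test_function test_function_mult \<psi>)
  qed
  then have I: "0 < \<bar>I\<bar>"
    using integral_by_parts_test_function[OF u \<psi> b] by (simp add: I_def \<psi>_def[symmetric])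
  obtain M where M: "0 < M" "\<And>x. \<bar>\<psi> x\<bar> \<le> M"
    using test_function_bounded[OF \<psi>] by blast
  obtain R where R: "0 < R" "\<And>x. R < norm x \<Longrightarrow> \<psi> x = 0"
    using test_function_support[OF \<psi>] by blast
  \<comment> \<open>A strictly positive volume bound, since \<open>V\<close> enters the denominator
    of \<open>\<delta>\<close>.\<close>
  obtain V where V: "0 < V" "emeasure lborel (cball (0::'a) R) \<le> ennreal V"
  proof -
    obtain r where "0 \<le> r" "emeasure lborel (cball (0::'a) R) = ennreal r"
      using emeasure_lborel_cball_finite[of "0::'a" R] by (cases "emeasure lborel (cball (0::'a) R)") auto
    then show ?thesis
      by (intro that[of "r + 1"]) (auto intro!: ennreal_leI)
  qed
  define N where "N = real DIM('a)"
  define \<delta> where "\<delta> = \<bar>I\<bar> / (2 * M * V)"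
  have \<delta>: "0 < \<delta>"
    using I M(1) V(1) by (simp add: \<delta>_def)
  \<comment> \<open>What remains after absorption: half of
    \<open>c powr (1 - N) * \<bar>I\<bar>\<close>, divided by the coefficient
    \<open>M * \<epsilon> powr (1 - q)\<close> of the \<open>q\<close>-th power integral, is
    \<open>B * c powr (q - N)\<close>.\<close>
  define B where "B = \<bar>I\<bar> / (2 * M) * \<delta> powr (q - 1)"
  have B: "0 < B"
    using I M(1) \<delta> by (simp add: B_def)
  show ?thesis
  proof (rule that[of "B powr (1 / q)"])
    fix c :: real and G
    assume c: "0 < c" and G: "weak_gradient UNIV (\<lambda>x. u (c *\<^sub>R x)) G"
    define K where "K = cball (0::'a) (R / c)"
    define \<epsilon> where "\<epsilon> = c * \<delta>"
    have \<epsilon>: "0 < \<epsilon>"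
      using c \<delta> by (simp add: \<epsilon>_def)
    define J where "J = (\<integral>\<^sup>+x. ennreal (norm (G x) powr q) \<partial>lebesgue)"
    \<comment> \<open>Local integrability yields measurability of \<open>G\<close> on the compact
      set \<open>K\<close>, which contains the support of \<open>\<psi> (c x)\<close>. Cutting off
      to \<open>K\<close> makes the integrand measurable, and monotonicity compares it with the full
      integral \<open>J\<close>.\<close>
    define F where "F x = ennreal (norm (G x) powr q) * indicator K x" for x
    have "integrable (lebesgue_on K) G"
      using G by (simp add: weak_gradient_def locally_integrable_def K_def)
    then have "G \<in> borel_measurable (lebesgue_on K)"
      by (rule borel_measurable_integrable)
    then have "(\<lambda>x. norm (G x) powr q) \<in> borel_measurable (lebesgue_on K)"
      by measurable
    then have F: "F \<in> borel_measurable lebesgue"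
      unfolding F_def by (subst borel_measurable_restrict_space_iff_ennreal[symmetric]) (auto simp: K_def)
    have K_sets: "K \<in> sets lebesgue"
      by (simp add: K_def)
    have K: "emeasure lebesgue K \<le> ennreal (c powr (- N) * V)"
    proof -
      have "emeasure lebesgue K = (\<integral>\<^sup>+x. indicator (cball (0::'a) R) (0 + c *\<^sub>R x) \<partial>lebesgue)"
      proof -
        have "indicator K = (\<lambda>x. indicator (cball (0::'a) R) (0 + c *\<^sub>R x) :: ennreal)"
          using c by (auto simp: K_def indicator_def field_simps)
        moreover have "emeasure lebesgue K = (\<integral>\<^sup>+x. indicator K x \<partial>lebesgue)"
          by (rule nn_integral_indicator[symmetric]) (simp add: K_def)
        ultimately show ?thesis
          by simp
      qed
      also have "\<dots> = ennreal (c powr (- N)) * emeasure lborel (cball (0::'a) R)"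
        using c by (subst nn_integral_lebesgue_affine[OF borel_measurable_indicator])
          (auto simp: N_def nn_integral_completion)
      also have "\<dots> \<le> ennreal (c powr (- N)) * ennreal V"
        by (intro mult_left_mono V(2)) auto
      finally show ?thesis
        using V(1) by (simp add: ennreal_mult)
    qed
    have bound: "ennreal (norm ((G x \<bullet> b) * \<psi> (c *\<^sub>R x))) \<le>
        ennreal (M * \<epsilon>) * indicator K x + ennreal (M * \<epsilon> powr (1 - q)) * F x" for x
    proof (cases "x \<in> K")
      case True
      \<comment> \<open>Where the norm of \<open>G x\<close> exceeds \<open>\<epsilon>\<close>,
        write it as the product of its powers \<open>1 - q\<close> and \<open>q\<close>; the former
        is at most \<open>\<epsilon> powr (1 - q)\<close> since
        \<open>1 - q \<le> 0\<close>.\<close>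
      have "norm (G x) \<le> \<epsilon> + \<epsilon> powr (1 - q) * norm (G x) powr q"
      proof (cases "norm (G x) \<le> \<epsilon>")
        case False
        then have "norm (G x) powr (1 - q) \<le> \<epsilon> powr (1 - q)"
          using \<epsilon> q by (intro powr_mono2') auto
        then have "norm (G x) powr (1 - q) * norm (G x) powr q \<le> \<epsilon> powr (1 - q) * norm (G x) powr q"
          by (intro mult_right_mono) auto
        then show ?thesis
          using False \<epsilon> by (simp add: powr_add[symmetric])
      qed (simp add: add_increasing2)
      then have "norm ((G x \<bullet> b) * \<psi> (c *\<^sub>R x)) \<le> (\<epsilon> + \<epsilon> powr (1 - q) * norm (G x) powr q) * M"
        using Basis_le_norm[OF b, of "G x"] M(2)[of "c *\<^sub>R x"]
        unfolding real_norm_def abs_mult by (intro mult_mono) (auto simp: \<epsilon> less_imp_le)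
      also have "\<dots> = M * \<epsilon> + M * \<epsilon> powr (1 - q) * norm (G x) powr q"
        by (simp add: algebra_simps)
      finally show ?thesis
        using True M(1) \<epsilon> by (simp add: F_def ennreal_leI flip: ennreal_mult ennreal_plus)
    next
      case False
      then have "\<psi> (c *\<^sub>R x) = 0"
        using c by (intro R(2)) (simp add: K_def field_simps)
      then show ?thesis by simp
    qed
    \<comment> \<open>The factor \<open>c\<close> comes from differentiating
      \<open>\<psi> (c x)\<close>, the factor \<open>c powr (- N)\<close> from the
      substitution.\<close>
    have "(\<integral>x. u (c *\<^sub>R x) * frechet_derivative (\<lambda>x. \<psi> (c *\<^sub>R x)) (at x) b \<partial>lebesgue) = c * (c powr (- N) * I)"
    proof -
      have "(\<lambda>x. u x * frechet_derivative \<psi> (at x) b) \<in> borel_measurable borel"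
        by (intro borel_measurable_test_function test_function_mult test_function_frechet_derivative u \<psi> b)
      from integral_lebesgue_scale[OF this c] show ?thesis
        by (simp add: frechet_derivative_scale[OF \<psi>] I_def N_def mult.left_commute[of "u _" c])
    qed
    also have "c * (c powr (- N) * I) = c powr (1 - N) * I"
      using c by (simp add: mult.assoc[symmetric] powr_mult_base)
    finally have "(\<integral>x. (G x \<bullet> b) * \<psi> (c *\<^sub>R x) \<partial>lebesgue) = - (c powr (1 - N) * I)"
      using G test_function_scale[OF \<psi> c] b unfolding weak_gradient_def lebesgue_on_UNIV_eq by fastforce
    then have "ennreal (c powr (1 - N) * \<bar>I\<bar>) = ennreal (norm (\<integral>x. (G x \<bullet> b) * \<psi> (c *\<^sub>R x) \<partial>lebesgue))"
      by (simp add: abs_mult)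
    also have "\<dots> \<le> (\<integral>\<^sup>+x. ennreal (norm ((G x \<bullet> b) * \<psi> (c *\<^sub>R x))) \<partial>lebesgue)"
    \<comment> \<open>In the non-integrable case the Bochner integral is \<open>0\<close> by
      convention, and the bound holds trivially.\<close>
    proof (cases "integrable lebesgue (\<lambda>x. (G x \<bullet> b) * \<psi> (c *\<^sub>R x))")
      case True
      then show ?thesis
        by (rule integral_norm_bound_ennreal)
    next
      case False
      then show ?thesis
        by (subst not_integrable_integral_eq) simp_all
    qed
    also have "\<dots> \<le> (\<integral>\<^sup>+x. ennreal (M * \<epsilon>) * indicator K x +
        ennreal (M * \<epsilon> powr (1 - q)) * F x \<partial>lebesgue)"
      by (intro nn_integral_mono bound)
    also have "\<dots> = ennreal (M * \<epsilon>) * emeasure lebesgue K +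
        ennreal (M * \<epsilon> powr (1 - q)) * (\<integral>\<^sup>+x. F x \<partial>lebesgue)"
      by (simp only: nn_integral_add nn_integral_cmult nn_integral_indicator K_sets F
        borel_measurable_times_ennreal borel_measurable_const borel_measurable_indicator)
    also have "\<dots> \<le> ennreal (M * \<epsilon>) * ennreal (c powr (- N) * V) + ennreal (M * \<epsilon> powr (1 - q)) * J"
      unfolding J_def by (intro add_mono mult_left_mono K nn_integral_mono) (simp_all add: F_def indicator_def)
    finally have est: "ennreal (c powr (1 - N) * \<bar>I\<bar>) \<le>
        ennreal (M * \<epsilon>) * ennreal (c powr (- N) * V) + ennreal (M * \<epsilon> powr (1 - q)) * J" .
    have "ennreal (B * c powr (q - N)) \<le> J"
    proof (cases J)
      case (real r)
      have "c powr (1 - N) * \<bar>I\<bar> \<le> M * \<epsilon> * (c powr (- N) * V) + M * \<epsilon> powr (1 - q) * r"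
        using est M(1) \<epsilon> V(1) real by (simp flip: ennreal_mult ennreal_plus)
      moreover have "M * \<epsilon> * (c powr (- N) * V) = c powr (1 - N) * \<bar>I\<bar> / 2"
      proof -
        have "M * \<epsilon> * (c powr (- N) * V) = M * V * \<delta> * (c * c powr (- N))"
          by (simp add: \<epsilon>_def)
        also have "M * V * \<delta> = \<bar>I\<bar> / 2"
          using M(1) V(1) by (simp add: \<delta>_def)
        also have "c * c powr (- N) = c powr (1 - N)"
          using c by (simp add: powr_mult_base)
        finally show ?thesis by simp
      qed
      ultimately have "c powr (1 - N) * \<bar>I\<bar> / 2 \<le> M * \<epsilon> powr (1 - q) * r"
        by linarith
      then have "c powr (1 - N) * \<bar>I\<bar> / 2 * (\<epsilon> powr (q - 1) / M) \<le> M * \<epsilon> powr (1 - q) * r * (\<epsilon> powr (q - 1) / M)"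
        using M(1) by (intro mult_right_mono) auto
      also have "\<dots> = r * (\<epsilon> powr (1 - q) * \<epsilon> powr (q - 1))"
        using M(1) by simp
      also have "\<epsilon> powr (1 - q) * \<epsilon> powr (q - 1) = 1"
        using \<epsilon> by (simp add: powr_add[symmetric])
      also have "c powr (1 - N) * \<bar>I\<bar> / 2 * (\<epsilon> powr (q - 1) / M) = B * (c powr (1 - N) * c powr (q - 1))"
        using c \<delta> by (simp add: B_def \<epsilon>_def powr_mult)
      also have "c powr (1 - N) * c powr (q - 1) = c powr (q - N)"
        by (simp add: powr_add[symmetric])
      finally show ?thesis
        using real by (simp add: ennreal_leI)
    qed simp
    then have "ennpowr (ennreal (B * c powr (q - N))) (1 / q) \<le> Lp_norm UNIV q G"
      using q unfolding Lp_norm_lebesgue J_def[symmetric] by (intro ennpowr_mono) auto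
    also have "ennpowr (ennreal (B * c powr (q - N))) (1 / q) = ennreal (B powr (1 / q) * c powr (1 - N / q))"
    proof -
      have "(q - N) * (1 / q) = 1 - N / q"
        using q by (simp add: field_simps)
      then show ?thesis
        using B by (simp add: ennpowr_ennreal powr_mult powr_powr)
    qed
    finally show "ennreal (B powr (1 / q) * c powr (1 - real DIM('a) / q)) \<le> Lp_norm UNIV q G"
      by (simp add: N_def)
  qed (use B in simp)
qed

text \<open>For \<open>s = 1\<close> the bound is uniform over all weak gradients and so passes to
  the infimum. For \<open>s < 1\<close> the seminorm at \<open>c = 1\<close> is positive and finite
  and scales exactly; positivity in the fractional case uses a point \<open>y0\<close> outside the
  support, where \<open>u\<close> differs from \<open>u x0\<close>.\<close>

lemma sobolev_seminorm_test_function_ge: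
  fixes u :: "'a::euclidean_space \<Rightarrow> real"
  assumes u: "test_function UNIV u" and x0: "u x0 \<noteq> 0" and s: "0 \<le> s" "s \<le> 1" and q: "1 \<le> q"
  obtains A where "0 < A"
    "\<And>c. 0 < c \<Longrightarrow> ennreal (A * c powr (s - real DIM('a) / q)) \<le> sobolev_seminorm UNIV s q (\<lambda>x. u (c *\<^sub>R x))"
proof (cases "s = 1")
  case True
  obtain A where "0 < A" "\<And>c G. 0 < c \<Longrightarrow> weak_gradient UNIV (\<lambda>x. u (c *\<^sub>R x)) G \<Longrightarrow>
      ennreal (A * c powr (1 - real DIM('a) / q)) \<le> Lp_norm UNIV q G"
    using weak_gradient_scale_lower_bound[OF u x0 q] by blast
  then show ?thesis
    using True by (intro that[of A]) (auto simp: sobolev_seminorm_def intro!: INF_greatest)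
next
  case False
  note cont = test_functionD(4)[OF u]
  have s1: "s < 1"
    using False s by simp
  obtain R where R: "0 < R" "\<And>x. R < norm x \<Longrightarrow> u x = 0"
    using test_function_support[OF u] by blast
  have "0 < sobolev_seminorm UNIV s q u"
  proof (cases "s = 0")
    case True
    then show ?thesis
      using Lp_norm_pos[OF cont x0] by (simp add: sobolev_seminorm_def)
  next
    case False
    then have s0: "0 < s"
      using s by simp
    obtain y0 :: 'a where "norm y0 = R + 1"
      using R(1) vector_choose_size[of "R + 1"] by auto
    then have "u x0 \<noteq> u y0"
      using x0 R(2)[of y0] by simp
    then show ?thesis
      unfolding sobolev_seminorm_gagliardo[OF s0 s1]
      using gagliardo_pos[OF cont] gagliardo_const_pos[OF s0 s1 q, of "DIM('a)"]
      by (intro ennpowr_pos) (auto simp: ennreal_zero_less_mult_iff)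
  qed
  moreover have "sobolev_seminorm UNIV s q u < \<infinity>"
  proof -
    obtain B where "\<And>c. 0 < c \<Longrightarrow> sobolev_seminorm UNIV s q (\<lambda>x. u (c *\<^sub>R x)) \<le> ennreal (B * c powr (s - real DIM('a) / q))"
      using sobolev_seminorm_test_function_le[OF u s q] by blast
    from this[of 1] show ?thesis
      by (auto intro: le_less_trans)
  qed
  ultimately obtain r where "0 < r" "sobolev_seminorm UNIV s q u = ennreal r"
    by (rule ennpowr_exhaust)
  then show ?thesis
    using sobolev_seminorm_scale[OF cont _ s(1) s1, of _ q] q
    by (intro that[of r]) (auto simp: mult.commute ennreal_mult)
qed

lemma sobolev_norm_ge:
  assumes "0 < q"
  shows "sobolev_seminorm \<Omega> s q u \<le> sobolev_norm \<Omega> s (ereal q) u"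
    and "Lp_norm \<Omega> q u \<le> sobolev_norm \<Omega> s (ereal q) u"
proof -
  have ge: "x \<le> ennpowr (ennpowr x q + ennpowr y q) (1 / q)" for x y
  proof -
    have "x = ennpowr (ennpowr x q) (1 / q)"
      using assms by (simp add: ennpowr_ennpowr_inverse)
    also have "\<dots> \<le> ennpowr (ennpowr x q + ennpowr y q) (1 / q)"
      using assms by (intro ennpowr_mono) auto
    finally show ?thesis .
  qed
  show "sobolev_seminorm \<Omega> s q u \<le> sobolev_norm \<Omega> s (ereal q) u"
    using ge by (simp add: sobolev_norm_def sobolev_seminorm_def Let_def)
  show "Lp_norm \<Omega> q u \<le> sobolev_norm \<Omega> s (ereal q) u"
    using ge[of "Lp_norm \<Omega> q u" "sobolev_seminorm \<Omega> s q u"]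
    by (simp add: sobolev_norm_def Let_def add.commute[of "ennpowr (sobolev_seminorm \<Omega> s q u) q"])
qed

text \<open>The factor arises as \<open>2 powr (1 / q)\<close>, which is at most \<open>2\<close>
  for \<open>q \<ge> 1\<close>.\<close>

lemma sobolev_norm_le:
  assumes "1 \<le> q" "sobolev_seminorm \<Omega> s q u \<le> m" "Lp_norm \<Omega> q u \<le> m"
  shows "sobolev_norm \<Omega> s (ereal q) u \<le> 2 * m"
proof -
  have "ennpowr (ennpowr (sobolev_seminorm \<Omega> s q u) q + ennpowr (Lp_norm \<Omega> q u) q) (1 / q) \<le>
      ennpowr (ennpowr m q + ennpowr m q) (1 / q)"
    using assms by (intro ennpowr_mono add_mono) auto
  also have "ennpowr m q + ennpowr m q = ennreal 2 * ennpowr m q"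
    by (simp add: mult_2)
  also have "ennpowr \<dots> (1 / q) = ennreal (2 powr (1 / q)) * m"
    using assms(1) by (subst ennpowr_cmult) (auto simp: ennpowr_ennpowr_inverse)
  also have "\<dots> \<le> ennreal 2 * m"
    using assms(1) powr_mono[of "1 / q" 1 2] by (intro mult_right_mono ennreal_leI) auto
  finally have "ennpowr (ennpowr (sobolev_seminorm \<Omega> s q u) q + ennpowr (Lp_norm \<Omega> q u) q) (1 / q) \<le> 2 * m"
    by simp
  moreover have "Lp_norm \<Omega> q u \<le> 2 * m"
    using assms(3) by (simp add: mult_2 add_increasing2)
  ultimately show ?thesis
    by (simp add: sobolev_norm_def Let_def)
qed

subsection \<open>Failure of the embedding\<close>

text \<open>Half of the value at \<open>x0\<close> is exceeded on a nonempty open set, which must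
  contain a point where the essential supremum is an upper bound.\<close>

lemma Linf_norm_scale_lower_bound:
  fixes u :: "'a::euclidean_space \<Rightarrow> real"
  assumes u: "continuous_on UNIV u" and c: "0 < c"
  shows "ennreal (\<bar>u x0\<bar> / 2) \<le> Linf_norm UNIV (\<lambda>x. u (c *\<^sub>R x))"
proof (cases "u x0 = 0")
  case False
  let ?S = "{x. \<bar>u x0\<bar> / 2 < \<bar>u (c *\<^sub>R x)\<bar>}"
  have "AE x in lebesgue. ennreal \<bar>u (c *\<^sub>R x)\<bar> \<le> Linf_norm UNIV (\<lambda>x. u (c *\<^sub>R x))"
    unfolding Linf_norm_def lebesgue_on_UNIV_eq by (rule esssup_AE)
  moreover have "open ?S"
    by (intro open_Collect_less continuous_intros continuous_on_compose2[OF u]) auto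
  moreover have "x0 /\<^sub>R c \<in> ?S"
    using c False by simp
  then have "?S \<noteq> {}"
    by blast
  ultimately obtain x where x: "x \<in> ?S" "ennreal \<bar>u (c *\<^sub>R x)\<bar> \<le> Linf_norm UNIV (\<lambda>x. u (c *\<^sub>R x))"
    by (rule AE_lebesgue_open_obtains)
  have "ennreal (\<bar>u x0\<bar> / 2) \<le> ennreal \<bar>u (c *\<^sub>R x)\<bar>"
    using x(1) by (intro ennreal_leI) simp
  then show ?thesis
    using x(2) by (rule order_trans)
qed simp

text \<open>For \<open>s > 0\<close> every representative \<open>v\<close> agrees with the dilated
  function at some \<open>x\<close> where its modulus exceeds half of
  \<open>\<bar>u x0\<bar>\<close>, and at some \<open>y\<close> just outside its support. These
  points are at distance at most \<open>(2 R + 1) / c\<close>, so the Hoelder quotient of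
  \<open>v\<close> at this pair is of order at least \<open>c powr s\<close>.\<close>

lemma sobolev_norm_infinity_test_function_ge:
  fixes u :: "'a::euclidean_space \<Rightarrow> real"
  assumes u: "test_function UNIV u" and x0: "u x0 \<noteq> 0" and s: "0 \<le> s"
  obtains A where "0 < A"
    "\<And>c. 0 < c \<Longrightarrow> ennreal (A * c powr s) \<le> sobolev_norm UNIV s \<infinity> (\<lambda>x. u (c *\<^sub>R x))"
proof (cases "s = 0")
  case True
  then show ?thesis
    using Linf_norm_scale_lower_bound[OF test_functionD(4)[OF u]] x0
    by (intro that[of "\<bar>u x0\<bar> / 2"]) (auto simp: sobolev_norm_def)
next
  case False
  note cont = test_functionD(4)[OF u]
  obtain R where R: "0 < R" "\<And>x. R < norm x \<Longrightarrow> u x = 0"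
    using test_function_support[OF u] by blast
  define A where "A = \<bar>u x0\<bar> / 2 / (2 * R + 1) powr s"
  have A: "0 < A"
    using x0 R(1) by (simp add: A_def)
  show ?thesis
  proof (rule that[OF A])
    fix c :: real
    assume c: "0 < c"
    have "ennreal (A * c powr s) \<le> Linf_norm UNIV v + hoelder_seminorm UNIV s v"
      if "AE x in lebesgue_on UNIV. v x = u (c *\<^sub>R x)" for v
    proof -
      have ae: "AE x in lebesgue. v x = u (c *\<^sub>R x)"
        using that unfolding lebesgue_on_UNIV_eq .
      let ?S = "{x. \<bar>u x0\<bar> / 2 < \<bar>u (c *\<^sub>R x)\<bar>}"
      \<comment> \<open>The inner radius forces \<open>u (c y) = 0\<close>, the outer one keeps
        \<open>y\<close> close to \<open>x\<close>; both inequalities are strict so that the shell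
        is open.\<close>
      let ?T = "{y::'a. R < norm (c *\<^sub>R y)} \<inter> {y. norm (c *\<^sub>R y) < R + 1}"
      have "open ?S"
        by (intro open_Collect_less continuous_intros continuous_on_compose2[OF cont]) auto
      moreover have "x0 /\<^sub>R c \<in> ?S"
        using c x0 by simp
      then have "?S \<noteq> {}"
        by blast
      ultimately obtain x where x: "x \<in> ?S" "v x = u (c *\<^sub>R x)"
        using AE_lebesgue_open_obtains[OF ae] by blast
      have "open ?T"
        by (intro open_Int open_Collect_less continuous_intros)
      moreover have "?T \<noteq> {}"
      proof -
        obtain y :: 'a where "norm y = R + 1 / 2"
          using R(1) vector_choose_size[of "R + 1 / 2"] by auto
        moreover have "c *\<^sub>R (y /\<^sub>R c) = y"
          using c by simp
        ultimately have "y /\<^sub>R c \<in> ?T"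
          by (simp only: mem_Collect_eq Int_iff) simp
        then show ?thesis
          by blast
      qed
      ultimately obtain y where y: "y \<in> ?T" "v y = u (c *\<^sub>R y)"
        using AE_lebesgue_open_obtains[OF ae] by blast
      have uy: "u (c *\<^sub>R y) = 0"
        using y R(2) by auto
      have diff: "\<bar>u x0\<bar> / 2 \<le> \<bar>v x - v y\<bar>"
        using x y uy by simp
      have ne: "x \<noteq> y"
        using x y uy x0 by auto
      have "norm (c *\<^sub>R x) \<le> R"
        using x(1) x0 R(2)[of "c *\<^sub>R x"] by (cases "R < norm (c *\<^sub>R x)") auto
      then have "norm (c *\<^sub>R x - c *\<^sub>R y) \<le> 2 * R + 1"
        using y(1) norm_triangle_ineq4[of "c *\<^sub>R x" "c *\<^sub>R y"] by simp
      then have "c * norm (x - y) \<le> 2 * R + 1"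
        using c by (simp flip: scaleR_diff_right)
      then have "(c * norm (x - y)) powr s \<le> (2 * R + 1) powr s"
        using s c by (intro powr_mono2) auto
      then have "norm (x - y) powr s \<le> (2 * R + 1) powr s / c powr s"
        using c by (simp add: powr_mult field_simps)
      then have "A * c powr s * norm (x - y) powr s \<le> A * c powr s * ((2 * R + 1) powr s / c powr s)"
        using A by (intro mult_left_mono) auto
      also have "\<dots> = \<bar>u x0\<bar> / 2"
        using c R(1) by (simp add: A_def)
      finally have "A * c powr s \<le> \<bar>v x - v y\<bar> / norm (x - y) powr s"
        using diff ne by (simp add: pos_le_divide_eq)
      then have "ennreal (A * c powr s) \<le> ennreal (\<bar>v x - v y\<bar> / norm (x - y) powr s)"
        by (rule ennreal_leI)
      also have "\<dots> \<le> hoelder_seminorm UNIV s v"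
        unfolding hoelder_seminorm_def using ne by (intro SUP_upper2[of "(x, y)"]) auto
      finally show ?thesis
        by (simp add: add_increasing)
    qed
    then show "ennreal (A * c powr s) \<le> sobolev_norm UNIV s \<infinity> (\<lambda>x. u (c *\<^sub>R x))"
      using False by (auto simp: sobolev_norm_def intro!: INF_greatest)
  qed
qed

section \<open>Dilated test functions in the source space\<close>

lemma test_function_in_sobolev_space:
  fixes u :: "'a::euclidean_space \<Rightarrow> real"
  assumes u: "test_function UNIV u" and s: "0 \<le> s" "s \<le> 1" and p: "1 \<le> p"
  shows "u \<in> sobolev_space UNIV s (ereal p)"
proof -
  obtain A where "\<And>c. 0 < c \<Longrightarrow> sobolev_seminorm UNIV s p (\<lambda>x. u (c *\<^sub>R x)) \<le> ennreal (A * c powr (s - real DIM('a) / p))"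
    using sobolev_seminorm_test_function_le[OF u s p] by blast
  from this[of 1] have "sobolev_seminorm UNIV s p u < \<infinity>"
    by (auto intro: le_less_trans)
  moreover obtain R where "\<And>x. R < norm x \<Longrightarrow> u x = 0"
    using test_function_support[OF u] by blast
  then have "Lp_norm UNIV p u < \<infinity>"
    using p by (intro Lp_norm_finite[OF test_functionD(4)[OF u]]) auto
  moreover have "u \<in> borel_measurable lebesgue"
    using borel_measurable_test_function[OF u] by (simp add: measurable_completion)
  ultimately show ?thesis
    by (simp add: sobolev_space_def lebesgue_on_UNIV_eq)
qed

text \<open>Since \<open>s \<ge> 0\<close>, the power \<open>c powr (s - N / p)\<close> of the
  seminorm dominates for \<open>c \<ge> 1\<close> and the power \<open>c powr (- (N / p))\<close> of
  the Lebesgue part for \<open>c \<le> 1\<close>. The latter is treated as the seminorm of order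
  \<open>0\<close>.\<close>

lemma sobolev_norm_test_function_le:
  fixes u :: "'a::euclidean_space \<Rightarrow> real"
  assumes u: "test_function UNIV u" and s: "0 \<le> s" "s \<le> 1" and p: "1 \<le> p"
  obtains D where "0 < D"
    "\<And>c. 1 \<le> c \<Longrightarrow> sobolev_norm UNIV s (ereal p) (\<lambda>x. u (c *\<^sub>R x)) \<le> ennreal (D * c powr (s - real DIM('a) / p))"
    "\<And>c. 0 < c \<Longrightarrow> c \<le> 1 \<Longrightarrow> sobolev_norm UNIV s (ereal p) (\<lambda>x. u (c *\<^sub>R x)) \<le> ennreal (D * c powr (- (real DIM('a) / p)))"
proof -
  obtain A where A: "0 < A"
    "\<And>c. 0 < c \<Longrightarrow> sobolev_seminorm UNIV s p (\<lambda>x. u (c *\<^sub>R x)) \<le> ennreal (A * c powr (s - real DIM('a) / p))"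
    using sobolev_seminorm_test_function_le[OF u s p] by blast
  obtain B where B: "0 < B"
    "\<And>c. 0 < c \<Longrightarrow> sobolev_seminorm UNIV 0 p (\<lambda>x. u (c *\<^sub>R x)) \<le> ennreal (B * c powr (0 - real DIM('a) / p))"
    using sobolev_seminorm_test_function_le[OF u _ _ p, of 0] by auto
  have le: "sobolev_norm UNIV s (ereal p) (\<lambda>x. u (c *\<^sub>R x)) \<le> ennreal (2 * max A B * c powr e)"
    if c: "0 < c" and e: "c powr (s - real DIM('a) / p) \<le> c powr e" "c powr (- (real DIM('a) / p)) \<le> c powr e" for c e
  proof -
    have "sobolev_seminorm UNIV s p (\<lambda>x. u (c *\<^sub>R x)) \<le> ennreal (max A B * c powr e)"
      using A e by (intro order_trans[OF A(2)[OF c]] ennreal_leI mult_mono) auto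
    moreover have "sobolev_seminorm UNIV 0 p (\<lambda>x. u (c *\<^sub>R x)) \<le> ennreal (max A B * c powr e)"
      using B(1) e by (intro order_trans[OF B(2)[OF c]] ennreal_leI mult_mono) auto
    then have "Lp_norm UNIV p (\<lambda>x. u (c *\<^sub>R x)) \<le> ennreal (max A B * c powr e)"
      by (simp add: sobolev_seminorm_def)
    ultimately have "sobolev_norm UNIV s (ereal p) (\<lambda>x. u (c *\<^sub>R x)) \<le> 2 * ennreal (max A B * c powr e)"
      by (rule sobolev_norm_le[OF p])
    then show ?thesis
      using A(1) by (simp add: ennreal_mult mult.assoc)
  qed
  show ?thesis
  proof (rule that[of "2 * max A B"])
    show "sobolev_norm UNIV s (ereal p) (\<lambda>x. u (c *\<^sub>R x)) \<le> ennreal (2 * max A B * c powr (s - real DIM('a) / p))"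
      if "1 \<le> c" for c
      using that s by (intro le powr_mono) auto
    show "sobolev_norm UNIV s (ereal p) (\<lambda>x. u (c *\<^sub>R x)) \<le> ennreal (2 * max A B * c powr (- (real DIM('a) / p)))"
      if "0 < c" "c \<le> 1" for c
      using that s by (intro le powr_mono') auto
  qed (use A in simp)
qed

lemma not_powr_le_powr:
  fixes A D \<alpha> \<beta> :: real
  assumes "0 < A" "\<beta> < \<alpha>" "\<And>c. 1 \<le> c \<Longrightarrow> A * c powr \<alpha> \<le> D * c powr \<beta>"
  shows False
proof -
  \<comment> \<open>Chosen so that \<open>A * c powr (\<alpha> - \<beta>)\<close> equals
    \<open>\<bar>D\<bar> + A\<close>, which exceeds \<open>D\<close>.\<close>
  define c where "c = (\<bar>D\<bar> / A + 1) powr (1 / (\<alpha> - \<beta>))"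
  have c: "1 \<le> c"
    unfolding c_def using assms(1,2) by (intro ge_one_powr_ge_zero) auto
  have "A * c powr (\<alpha> - \<beta>) = \<bar>D\<bar> + A"
    using assms(1,2) by (simp add: c_def powr_powr field_simps add_pos_nonneg)
  moreover have "A * c powr \<alpha> = A * c powr (\<alpha> - \<beta>) * c powr \<beta>"
    using c by (simp add: powr_diff)
  ultimately have "(\<bar>D\<bar> + A) * c powr \<beta> \<le> D * c powr \<beta>"
    using assms(3)[OF c] by simp
  then have "\<bar>D\<bar> + A \<le> D"
    using c by simp
  then show False
    using assms(1) by linarith
qed

theorem proposition2p8:
  fixes s s' p :: real and p' :: ereal
  assumes "0 \<le> s" and "s \<le> 1"
    and "1 \<le> p"
    and "s * p < real CARD('n::finite)"
    and "s \<noteq> p"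
    and "0 \<le> s'" and "s' \<le> 1"
    and "1 \<le> p'"
    and "\<not> (0 \<le> s' \<and> s' \<le> s \<and> ereal p \<le> p' \<and>
           p' \<le> ereal (real CARD('n) * p / (real CARD('n) - (s - s') * p)))"
  shows "\<not> sobolev_embedded (UNIV :: (real ^ 'n) set) s (ereal p) s' p'"
proof
  assume emb: "sobolev_embedded (UNIV :: (real ^ 'n) set) s (ereal p) s' p'"
  define N where "N = real CARD('n)"
  have N: "real DIM(real ^ 'n) = N"
    by (simp add: N_def)
  obtain u :: "real ^ 'n \<Rightarrow> real" where u: "test_function UNIV u" and u0: "u 0 \<noteq> 0"
    using ex_test_function by blast
  obtain D where D: "0 < D"
    "\<And>c. 1 \<le> c \<Longrightarrow> sobolev_norm UNIV s (ereal p) (\<lambda>x. u (c *\<^sub>R x)) \<le> ennreal (D * c powr (s - N / p))"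
    "\<And>c. 0 < c \<Longrightarrow> c \<le> 1 \<Longrightarrow> sobolev_norm UNIV s (ereal p) (\<lambda>x. u (c *\<^sub>R x)) \<le> ennreal (D * c powr (- (N / p)))"
    using sobolev_norm_test_function_le[OF u assms(1-3)] unfolding N by blast
  obtain C where C: "\<And>v. v \<in> sobolev_space UNIV s (ereal p) \<Longrightarrow>
      sobolev_norm (UNIV :: (real ^ 'n) set) s' p' v \<le> ennreal C * sobolev_norm UNIV s (ereal p) v"
    using emb unfolding sobolev_embedded_def by blast
  \<comment> \<open>Translates the embedding into an inequality between real powers of
    \<open>c\<close>. As \<open>ennreal C\<close> is \<open>0\<close> for negative \<open>C\<close>,
    the real constant is \<open>max C 0\<close>.\<close>
  have le: "A * c powr \<alpha> \<le> max C 0 * D * c powr \<beta>"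
    if c: "0 < c" and A: "ennreal (A * c powr \<alpha>) \<le> sobolev_norm UNIV s' p' (\<lambda>x. u (c *\<^sub>R x))"
      and B: "sobolev_norm UNIV s (ereal p) (\<lambda>x. u (c *\<^sub>R x)) \<le> ennreal (D * c powr \<beta>)" for A c \<alpha> \<beta>
  proof -
    note A
    also have "sobolev_norm UNIV s' p' (\<lambda>x. u (c *\<^sub>R x)) \<le> ennreal C * sobolev_norm UNIV s (ereal p) (\<lambda>x. u (c *\<^sub>R x))"
      by (intro C test_function_in_sobolev_space test_function_scale u c assms)
    also have "\<dots> \<le> ennreal (max C 0) * ennreal (D * c powr \<beta>)"
      using B by (intro mult_mono ennreal_leI) auto
    also have "\<dots> = ennreal (max C 0 * D * c powr \<beta>)"
      using D(1) by (simp add: mult.assoc flip: ennreal_mult)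
    finally show ?thesis
      using D(1) by (subst (asm) ennreal_le_iff) auto
  qed
  show False
  proof (cases p')
    case PInf
    obtain A where A: "0 < A"
      "\<And>c. 0 < c \<Longrightarrow> ennreal (A * c powr s') \<le> sobolev_norm UNIV s' p' (\<lambda>x. u (c *\<^sub>R x))"
      using sobolev_norm_infinity_test_function_ge[OF u u0 assms(6)] unfolding PInf by blast
    have "s < N / p"
      using assms(3,4) by (simp add: N_def pos_less_divide_eq)
    then have "s - N / p < s'"
      using assms(6) by linarith
    then show False
      by (rule not_powr_le_powr[OF A(1)]) (rule le[OF _ A(2) D(2)]; simp)
  next
    case MInf
    then show False
      using assms(8) by simp
  next
    case (real q)
    have q: "1 \<le> q"
      using assms(8) real by simp
    show False
    proof (cases "q < p")
      case True
      obtain A where A: "0 < A"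
        "\<And>c. 0 < c \<Longrightarrow> ennreal (A * c powr (0 - N / q)) \<le> sobolev_seminorm UNIV 0 q (\<lambda>x. u (c *\<^sub>R x))"
        using sobolev_seminorm_test_function_ge[OF u u0 _ _ q, of 0] unfolding N by auto
      have *: "A * c powr (- (N / q)) \<le> max C 0 * D * c powr (- (N / p))" if "0 < c" "c \<le> 1" for c
        using A(2)[OF that(1)] sobolev_norm_ge(2)[of q UNIV "\<lambda>x. u (c *\<^sub>R x)" s'] q that
        by (intro le D(3)) (auto simp: real sobolev_seminorm_def)
      \<comment> \<open>Replacing \<open>c\<close> by \<open>1 / c\<close> turns the regime of small
        \<open>c\<close> into that of large \<open>c\<close> required by
        \<open>not_powr_le_powr\<close>.\<close>
      have "A * c powr (N / q) \<le> max C 0 * D * c powr (N / p)" if "1 \<le> c" for c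
      proof -
        have "A * (1 / c) powr (- (N / q)) \<le> max C 0 * D * (1 / c) powr (- (N / p))"
          using that by (intro *) auto
        then show ?thesis
          using that by (simp add: powr_minus_divide powr_divide)
      qed
      moreover have "N / p < N / q"
        using True q by (simp add: N_def divide_strict_left_mono)
      ultimately show False
        using not_powr_le_powr[OF A(1)] by blast
    next
      case False
      obtain A where A: "0 < A"
        "\<And>c. 0 < c \<Longrightarrow> ennreal (A * c powr (s' - N / q)) \<le> sobolev_seminorm UNIV s' q (\<lambda>x. u (c *\<^sub>R x))"
        using sobolev_seminorm_test_function_ge[OF u u0 assms(6,7) q] unfolding N by blast
      have "s - N / p < s' - N / q"
      proof (cases "s < s'")
        case True
        have "N / q \<le> N / p"
          using False assms(3) by (intro divide_left_mono) (auto simp: N_def)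
        then show ?thesis
          using True by linarith
      next
        case s: False
        have "(s - s') * p \<le> s * p"
          using assms(3,6) by (intro mult_right_mono) auto
        then have pos: "0 < N - (s - s') * p"
          using assms(4) by (simp add: N_def)
        \<comment> \<open>Here \<open>s' \<le> s\<close> and \<open>p \<le> q\<close>, so the upper
          limit is the condition that fails.\<close>
        have "N * p / (N - (s - s') * p) < q"
          using assms(6,9) s False by (auto simp: real N_def)
        then have "N * p < q * (N - (s - s') * p)"
          using pos by (simp add: pos_divide_less_eq)
        \<comment> \<open>Division by \<open>p q\<close> gives
          \<open>N / q < N / p - (s - s')\<close>, the required comparison of exponents.\<close>
        then have "N * p / (p * q) < q * (N - (s - s') * p) / (p * q)"
          using q assms(3) by (intro divide_strict_right_mono) auto
        then show ?thesis
          using q assms(3) by (simp add: diff_divide_distrib)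
      qed
      then show False
      proof (rule not_powr_le_powr[OF A(1)])
        fix c :: real
        assume "1 \<le> c"
        then show "A * c powr (s' - N / q) \<le> max C 0 * D * c powr (s - N / p)"
          using q by (intro le D(2) order_trans[OF A(2)] order_trans[OF sobolev_norm_ge(1)]) (auto simp: real)
      qed
    qed
  qed
qed

end
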